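(* Let $\lambda,\mu,\nu$ be partitions with $\mu\subseteq\lambda$. Then, for a finite signed alphabet $\mathcal{S}$ and a super tableau $t$ of shape $\nu$ over $\mathcal{S}$, the number $$c_{\lambda,\mu}^{\nu}:=\#\{S : S \text{ is a super skew tableau of shape } \lambda/\mu \text{ over } \mathcal{S} \text{ with } \mathrm{Rect}(S)=t\}$$ does not depend on $t$, and depends only on $\lambda$, $\mu$ and $\nu$. Moreover, for every finite signed alphabet $\mathcal{S}$ the identity $$S_{\lambda/\mu}=\sum_{\nu} c_{\lambda,\mu}^{\nu}\,S_{\nu}$$ holds in $R_{\mathcal{S}}$, where the sum is over all partitions $\nu$.
   Context: A signed alphabet is a totally ordered set $\mathcal{S}$ (here finite) with a map $\|\cdot\|:\mathcal{S}\to\{0,1\}$; $\mathcal{S}_0,\mathcal{S}_1$ are the sets of letters of degree $0$ and $1$ (no compatibility with the order is assumed). Partitions are finite weakly decreasing sequences of nonnegative integers (trailing zeros ignored, empty partition allowed), with Young diagram $\mathcal{Y}(\lambda)=\{(i,j): 1\le j\le\lambda_i\}$ ($i$ = row from the top, $j$ = column). $\mu\subseteq\lambda$ means $\mathcal{Y}(\mu)\subseteq\mathcal{Y}(\lambda)$, and then $\mathcal{Y}(\lambda/\mu)=\mathcal{Y}(\lambda)\setminus\mathcal{Y}(\mu)$. A super skew tableau of shape $\lambda/\mu$ over $\mathcal{S}$ is a map $U:\mathcal{Y}(\lambda/\mu)\to\mathcal{S}$ such that $U(i,j)\le U(i,j+1)$, with equality only if $\|U(i,j)\|=0$, and $U(i,j)\le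 U(i+1,j)$, with equality only if $\|U(i,j)\|=1$. A super tableau of shape $\lambda$ is the case $\mu=\emptyset$. $R_{row}$ of a super (skew) tableau is the word obtained by reading its rows from bottom to top, each row from left to right. The super plactic monoid $\mathbf{P}(\mathcal{S})$ is the quotient of the free monoid $\mathcal{S}^*$ by the congruence generated by, for $x\le y\le z$ in $\mathcal{S}$: $xzy=zxy$ (with $x=y$ only if $y\in\mathcal{S}_0$ and $y=z$ only if $y\in\mathcal{S}_1$) and $yxz=yzx$ (with $x=y$ only if $y\in\mathcal{S}_1$ and $y=z$ only if $y\in\mathcal{S}_0$). $R_{\mathcal{S}}=\mathbb{Z}[\mathbf{P}(\mathcal{S})]$ is its monoid ring; a super (skew) tableau $S$ is regarded as the element of $R_{\mathcal{S}}$ given by the class of $R_{row}(S)$. $S_\nu$ (resp. $S_{\lambda/\mu}$) in $R_{\mathcal{S}}$ is the sum of all super tableaux of shape $\nu$ (resp. super skew tableaux of shape $\lambda/\mu$) over $\mathcal{S}$ (an empty sum being $0$). Rectification: for a super skew tableau $S$ of shape $\lambda/\mu$, an inner corner is a box of $\mathcal{Y}(\mu)$ whose neighbours below and to the right are not in $\mathcal{Y}(\mu)$. A forward slide starts with the hole at an inner corner and repeats: with $x$ the entry below and $y$ the entry to the right of the hole, if $x<y$, or $x=y$ and $\|x\|=0$, then $x$ moves up into the hole; if $y<x$, or $x=y$ and $\|x\|=1$, then $y$ moves left into the hole; if only one of the entries exists it moves into the hole; if neither exists, the hole is removed from the diagram and the slide ends. $\mathrm{Rect}(S)$ is the super tableau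 obtained by performing forward slides until no inner corner remains (it does not depend on the choices of inner corners). *)

theory Defs
  imports "HOL-Algebra.Ring" "HOL-Library.Poly_Mapping"
begin

section \<open>Partitions and diagrams\<close>

text \<open>
  A partition is the function listing its parts, padded with zeros, so that sequences differing
  only in trailing zeros are equal. Rows and columns are numbered from 0.
\<close>

definition is_partition :: "(nat \<Rightarrow> nat) \<Rightarrow> bool" where
  "is_partition p \<longleftrightarrow> antimono p \<and> finite {i. p i \<noteq> 0}"

definition diagram :: "(nat \<Rightarrow> nat) \<Rightarrow> (nat \<times> nat) set" where
  "diagram p = {(i, j). j < p i}"

definition num_rows :: "(nat \<Rightarrow> nat) \<Rightarrow> nat" where
  "num_rows p = card {i. p i \<noteq> 0}"


section \<open>Signed alphabets and super skew tableaux\<close>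

definition finite_signed_alphabet :: "'a::linorder set \<Rightarrow> ('a \<Rightarrow> nat) \<Rightarrow> bool" where
  "finite_signed_alphabet A deg \<longleftrightarrow> finite A \<and> deg ` A \<subseteq> {0, 1}"

text \<open>A filling is a partial map whose domain is the set of filled boxes.\<close>

type_synonym 'a filling = "nat \<times> nat \<Rightarrow> 'a option"

definition super_skew_tableaux ::
    "'a::linorder set \<Rightarrow> ('a \<Rightarrow> nat) \<Rightarrow> (nat \<Rightarrow> nat) \<Rightarrow> (nat \<Rightarrow> nat) \<Rightarrow> 'a filling set" where
  "super_skew_tableaux A deg lam mu =
    {U. dom U = diagram lam - diagram mu \<and> ran U \<subseteq> A \<and>
        (\<forall>i j x y. U (i, j) = Some x \<and> U (i, j + 1) = Some y \<longrightarrow>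
            x \<le> y \<and> (x = y \<longrightarrow> deg x = 0)) \<and>
        (\<forall>i j x y. U (i, j) = Some x \<and> U (i + 1, j) = Some y \<longrightarrow>
            x \<le> y \<and> (x = y \<longrightarrow> deg x = 1))}"

abbreviation empty_partition :: "nat \<Rightarrow> nat" where
  "empty_partition \<equiv> \<lambda>_. 0"

abbreviation super_tableaux ::
    "'a::linorder set \<Rightarrow> ('a \<Rightarrow> nat) \<Rightarrow> (nat \<Rightarrow> nat) \<Rightarrow> 'a filling set" where
  "super_tableaux A deg nu \<equiv> super_skew_tableaux A deg nu empty_partition"

definition row_reading :: "(nat \<Rightarrow> nat) \<Rightarrow> (nat \<Rightarrow> nat) \<Rightarrow> 'a filling \<Rightarrow> 'a list" where
  "row_reading lam mu U =
    concat (map (\<lambda>i. map (\<lambda>j. the (U (i, j))) [mu i..<lam i]) (rev [0..<num_rows lam]))"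


section \<open>The super plactic monoid and its monoid ring\<close>

inductive plactic_gen :: "'a::linorder set \<Rightarrow> ('a \<Rightarrow> nat) \<Rightarrow> 'a list \<Rightarrow> 'a list \<Rightarrow> bool"
  for A deg where
  xzy: "\<lbrakk>x \<in> A; y \<in> A; z \<in> A; x \<le> y; y \<le> z; x = y \<longrightarrow> deg y = 0; y = z \<longrightarrow> deg y = 1\<rbrakk>
    \<Longrightarrow> plactic_gen A deg [x, z, y] [z, x, y]"
| yxz: "\<lbrakk>x \<in> A; y \<in> A; z \<in> A; x \<le> y; y \<le> z; x = y \<longrightarrow> deg y = 1; y = z \<longrightarrow> deg y = 0\<rbrakk>
    \<Longrightarrow> plactic_gen A deg [y, x, z] [y, z, x]"

inductive_set plactic_cong :: "'a::linorder set \<Rightarrow> ('a \<Rightarrow> nat) \<Rightarrow> ('a list \<times> 'a list) set"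
  for A deg where
  gen: "plactic_gen A deg u v \<Longrightarrow> (u, v) \<in> plactic_cong A deg"
| refl: "u \<in> lists A \<Longrightarrow> (u, u) \<in> plactic_cong A deg"
| sym: "(u, v) \<in> plactic_cong A deg \<Longrightarrow> (v, u) \<in> plactic_cong A deg"
| trans: "(u, v) \<in> plactic_cong A deg \<Longrightarrow> (v, w) \<in> plactic_cong A deg
    \<Longrightarrow> (u, w) \<in> plactic_cong A deg"
| mult: "(u, v) \<in> plactic_cong A deg \<Longrightarrow> (u', v') \<in> plactic_cong A deg
    \<Longrightarrow> (u @ u', v @ v') \<in> plactic_cong A deg"

definition plactic_monoid :: "'a::linorder set \<Rightarrow> ('a \<Rightarrow> nat) \<Rightarrow> 'a list set monoid" where
  "plactic_monoid A deg =
    \<lparr>carrier = lists A // plactic_cong A deg,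
     monoid.mult = (\<lambda>X Y. \<Union>x\<in>X. \<Union>y\<in>Y. plactic_cong A deg `` {x @ y}),
     one = plactic_cong A deg `` {[]}\<rparr>"

text \<open>
  The integral monoid ring: finitely supported integer combinations of monoid elements,
  with the convolution product.
\<close>

definition monoid_ring :: "('m, 'r) monoid_scheme \<Rightarrow> ('m \<Rightarrow>\<^sub>0 int) ring" where
  "monoid_ring M =
    \<lparr>carrier = {f. Poly_Mapping.keys f \<subseteq> carrier M},
     monoid.mult = (\<lambda>f g. \<Sum>x\<in>Poly_Mapping.keys f. \<Sum>y\<in>Poly_Mapping.keys g.
        Poly_Mapping.single (x \<otimes>\<^bsub>M\<^esub> y) (Poly_Mapping.lookup f x * Poly_Mapping.lookup g y)),
     one = Poly_Mapping.single \<one>\<^bsub>M\<^esub> 1,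
     zero = 0,
     add = (+)\<rparr>"

abbreviation plactic_ring :: "'a::linorder set \<Rightarrow> ('a \<Rightarrow> nat) \<Rightarrow> ('a list set \<Rightarrow>\<^sub>0 int) ring" where
  "plactic_ring A deg \<equiv> monoid_ring (plactic_monoid A deg)"

definition tableau_element ::
    "'a::linorder set \<Rightarrow> ('a \<Rightarrow> nat) \<Rightarrow> (nat \<Rightarrow> nat) \<Rightarrow> (nat \<Rightarrow> nat) \<Rightarrow> 'a filling
      \<Rightarrow> 'a list set \<Rightarrow>\<^sub>0 int" where
  "tableau_element A deg lam mu U =
    Poly_Mapping.single (plactic_cong A deg `` {row_reading lam mu U}) 1"

definition skew_schur ::
    "'a::linorder set \<Rightarrow> ('a \<Rightarrow> nat) \<Rightarrow> (nat \<Rightarrow> nat) \<Rightarrow> (nat \<Rightarrow> nat) \<Rightarrow> 'a list set \<Rightarrow>\<^sub>0 int" where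
  "skew_schur A deg lam mu =
    (\<Oplus>\<^bsub>plactic_ring A deg\<^esub>U\<in>super_skew_tableaux A deg lam mu. tableau_element A deg lam mu U)"

abbreviation schur ::
    "'a::linorder set \<Rightarrow> ('a \<Rightarrow> nat) \<Rightarrow> (nat \<Rightarrow> nat) \<Rightarrow> 'a list set \<Rightarrow>\<^sub>0 int" where
  "schur A deg nu \<equiv> skew_schur A deg nu empty_partition"


section \<open>Rectification\<close>

definition inner_corner :: "(nat \<times> nat) set \<Rightarrow> nat \<times> nat \<Rightarrow> bool" where
  "inner_corner M c \<longleftrightarrow>
    c \<in> M \<and> (fst c + 1, snd c) \<notin> M \<and> (fst c, snd c + 1) \<notin> M"

text \<open>
  \<open>slide deg h U V\<close>: sliding with the hole currently at the (unfilled) box \<open>h\<close> of the filling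
  \<open>U\<close> ends with the filling \<open>V\<close>.
\<close>

inductive slide :: "('a::linorder \<Rightarrow> nat) \<Rightarrow> nat \<times> nat \<Rightarrow> 'a filling \<Rightarrow> 'a filling \<Rightarrow> bool"
  for deg where
  stop: "\<lbrakk>U (i + 1, j) = None; U (i, j + 1) = None\<rbrakk> \<Longrightarrow> slide deg (i, j) U U"
| up: "\<lbrakk>U (i + 1, j) = Some x;
        \<forall>y. U (i, j + 1) = Some y \<longrightarrow> x < y \<or> x = y \<and> deg x = 0;
        slide deg (i + 1, j) (U((i, j) := Some x, (i + 1, j) := None)) V\<rbrakk>
    \<Longrightarrow> slide deg (i, j) U V"
| left: "\<lbrakk>U (i, j + 1) = Some y;
        \<forall>x. U (i + 1, j) = Some x \<longrightarrow> y < x \<or> x = y \<and> deg x = 1;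
        slide deg (i, j + 1) (U((i, j) := Some y, (i, j + 1) := None)) V\<rbrakk>
    \<Longrightarrow> slide deg (i, j) U V"

text \<open>
  A state consists of the current inner diagram and the current filling; the inner diagram has to
  be recorded because it is not determined by the filled boxes.
\<close>

inductive forward_slide ::
    "('a::linorder \<Rightarrow> nat) \<Rightarrow> (nat \<times> nat) set \<times> 'a filling \<Rightarrow> (nat \<times> nat) set \<times> 'a filling \<Rightarrow> bool"
  for deg where
  "\<lbrakk>inner_corner M c; slide deg c U V\<rbrakk> \<Longrightarrow> forward_slide deg (M, U) (M - {c}, V)"

definition rectifies_to ::
    "('a::linorder \<Rightarrow> nat) \<Rightarrow> (nat \<Rightarrow> nat) \<Rightarrow> 'a filling \<Rightarrow> 'a filling \<Rightarrow> bool" where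
  "rectifies_to deg mu U T \<longleftrightarrow>
    (\<exists>M. (forward_slide deg)\<^sup>*\<^sup>* (diagram mu, U) (M, T) \<and> (\<nexists>c. inner_corner M c))"

definition Rect :: "('a::linorder \<Rightarrow> nat) \<Rightarrow> (nat \<Rightarrow> nat) \<Rightarrow> 'a filling \<Rightarrow> 'a filling" where
  "Rect deg mu U = (THE T. rectifies_to deg mu U T)"

definition rect_count ::
    "'a::linorder set \<Rightarrow> ('a \<Rightarrow> nat) \<Rightarrow> (nat \<Rightarrow> nat) \<Rightarrow> (nat \<Rightarrow> nat) \<Rightarrow> 'a filling \<Rightarrow> nat" where
  "rect_count A deg lam mu t =
    card {U \<in> super_skew_tableaux A deg lam mu. Rect deg mu U = t}"

text \<open>
  The common value of \<open>rect_count\<close> over all finite signed alphabets and all super tableaux of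
  shape \<open>nu\<close>. A constant depending on the three partitions only cannot quantify over the types of
  letters; it is pinned down by the alphabets of natural numbers, of which every finite totally
  ordered set has an isomorphic copy. That \<open>rect_count\<close> takes this value for alphabets in an
  arbitrary linearly ordered type, including \<^typ>\<open>nat\<close>, is not built in and has to be proved;
  so is the existence of a common value.
\<close>

definition lr_coeff :: "(nat \<Rightarrow> nat) \<Rightarrow> (nat \<Rightarrow> nat) \<Rightarrow> (nat \<Rightarrow> nat) \<Rightarrow> nat" where
  "lr_coeff lam mu nu =
    (THE c. \<forall>(A :: nat set) deg t.
        finite_signed_alphabet A deg \<and> t \<in> super_tableaux A deg nu \<longrightarrow>
        rect_count A deg lam mu t = c)"

end

theory Submission
  imports Defs "HOL-Library.Sublist" "HOL-Library.Multiset" "HOL-Library.Product_Lexorder"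
begin

text \<open>
  Everything is reduced to standard fillings. Numbering the boxes of a super skew tableau by their
  letters, equal letters of degree 0 from left to right and of degree 1 from right to left in the
  row reading, gives a standard skew tableau. The slides preserve the Knuth class of the row
  reading, hence also the compatibility of the letters with the numbering, so rectification commutes
  with the numbering. By Greene's theorem a Knuth class contains at most one standard tableau of
  straight shape, so rectification does not depend on the choice of inner corners.

  For the count, let \<open>P\<close> be a standard tableau of shape \<open>\<mu>\<close>. Rectifying \<open>Q\<close> of shape \<open>\<lambda>/\<mu>\<close>
  along \<open>P\<close> to \<open>T\<close> of shape \<open>\<nu>\<close> also produces a tableau \<open>P'\<close> of shape \<open>\<lambda>/\<nu>\<close> recording the
  vacated boxes. The local rule of this tableau switching is an involution, so \<open>Q \<mapsto> P'\<close> is a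
  bijection from the \<open>Q\<close> rectifying to \<open>T\<close> onto the \<open>P'\<close> that rectify to \<open>P\<close> along \<open>T\<close>. Since
  rectification does not depend on the path, the number of such \<open>P'\<close> depends on the shape of \<open>T\<close> only.
\<close>

section \<open>Tableau switching\<close>

text \<open>Encoding a tableau as a chain of order ideals turns the hole of a slide into just
  another box of the chain: one move concerns two consecutive boxes, and its inverse is the same
  local rule. Letters are never moved. The letter function on labels is fixed once and only the list
  of boxes changes, so ties enter solely through a condition on the reading word; Knuth steps
  respect it because the label lying between the two that swap excludes a tie between them.
  Horizontal moves leave the reading word alone; in a vertical move an entry changes rows, and the
  two row words before and after are linked by row insertions. Greene's theorem determines a shape
  only. Applied to the labels below every \<open>m\<close>, it determines the whole chain of shapes,
  that is, the tableau. The count of standard fillings reached at the end mentions no alphabet, so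
  independence of alphabet, degree and letters all follow from the one equation
  \<open>rect_fibre\<close>.\<close>

definition order_ideal :: "(nat \<times> nat) set \<Rightarrow> bool" where
  "order_ideal D \<longleftrightarrow> finite D \<and> (\<forall>i j. (Suc i, j) \<in> D \<longrightarrow> (i, j) \<in> D) \<and> (\<forall>i j. (i, Suc j) \<in> D \<longrightarrow> (i, j) \<in> D)"

definition adj :: "nat \<times> nat \<Rightarrow> nat \<times> nat \<Rightarrow> bool" where
  "adj h b \<longleftrightarrow> b = (Suc (fst h), snd h) \<or> b = (fst h, Suc (snd h))"

text \<open>
  A standard skew tableau of shape \<open>E/D\<close> is encoded by the list of its boxes in the order of their
  entries.
\<close>

fun grows :: "(nat \<times> nat) set \<Rightarrow> (nat \<times> nat) list \<Rightarrow> (nat \<times> nat) set \<Rightarrow> bool" where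
  "grows D [] E \<longleftrightarrow> order_ideal D \<and> D = E"
| "grows D (b # bs) E \<longleftrightarrow> order_ideal D \<and> b \<notin> D \<and> grows (insert b D) bs E"

section \<open>Order ideals and partitions\<close>

lemma idealD:
  assumes "order_ideal D"
  shows "finite D" "(Suc i, j) \<in> D \<Longrightarrow> (i, j) \<in> D" "(i, Suc j) \<in> D \<Longrightarrow> (i, j) \<in> D"
  using assms unfolding order_ideal_def by blast+

lemma ideal_le:
  assumes "order_ideal D" "(i, j) \<in> D" "i' \<le> i" "j' \<le> j"
  shows "(i', j') \<in> D"
proof -
  have "(i', j) \<in> D" using assms(3,2)
    by (induction rule: inc_induct) (use idealD[OF assms(1)] in blast)+
  with assms(4) show ?thesis
    by (induction rule: inc_induct) (use idealD[OF assms(1)] in blast)+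
qed

lemma ideal_diagram: "is_partition p \<Longrightarrow> order_ideal (diagram p)"
proof -
  assume p: "is_partition p"
  then have a: "antimono p" and f: "finite {i. p i \<noteq> 0}" by (auto simp: is_partition_def)
  have "diagram p \<subseteq> {i. p i \<noteq> 0} \<times> {..<p 0}"
    using monotoneD[OF a, of 0] by (auto simp: diagram_def) (meson le0 less_le_trans)
  then have "finite (diagram p)" using f finite_subset by blast
  moreover have "j < p (Suc i) \<Longrightarrow> j < p i" for i j
    using monotoneD[OF a, of i "Suc i"] by auto
  ultimately show ?thesis by (auto simp: order_ideal_def diagram_def)
qed

text \<open>Closure under left neighbours makes each row an initial segment, so its cardinality is
  its length; closure under upper neighbours makes the lengths decrease.\<close>

lemma idealE:
  assumes "order_ideal D"
  obtains p where "is_partition p" "D = diagram p"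
proof
  define p where "p i = card {k. (i, k) \<in> D}" for i
  have fin: "finite {k. (i, k) \<in> D}" for i
    by (rule finite_subset[of _ "snd ` D"]) (use idealD(1)[OF assms] in force)+
  have iff: "(i, k) \<in> D \<longleftrightarrow> k < p i" for i k
  proof
    assume k: "(i, k) \<in> D"
    have "{..k} \<subseteq> {k. (i, k) \<in> D}" using ideal_le[OF assms k] by auto
    from card_mono[OF fin this] show "k < p i" by (simp add: p_def)
  next
    assume "k < p i"
    show "(i, k) \<in> D"
    proof (rule ccontr)
      assume n: "(i, k) \<notin> D"
      have "{k. (i, k) \<in> D} \<subseteq> {..<k}"
        using n ideal_le[OF assms, of i _ i k] by (auto simp flip: not_le)
      from card_mono[OF _ this] show False using \<open>k < p i\<close> by (simp add: p_def)
    qed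
  qed
  show "D = diagram p" using iff by (auto simp: diagram_def)
  have "p i' \<le> p i" if "i \<le> i'" for i i'
  proof (rule ccontr)
    assume "\<not> p i' \<le> p i"
    then have "(i', p i) \<in> D" using iff by simp
    then have "(i, p i) \<in> D" using ideal_le[OF assms] that by blast
    then show False using iff by simp
  qed
  moreover have "{i. p i \<noteq> 0} \<subseteq> fst ` D" using iff by (force intro: rev_image_eqI)
  ultimately show "is_partition p"
    unfolding is_partition_def using idealD(1)[OF assms] finite_surj by (blast intro!: antimonoI)
qed

lemma diagram_inject: "diagram p = diagram q \<Longrightarrow> p = q"
proof (rule ext)
  fix i
  assume "diagram p = diagram q"
  then have "{j. (i, j) \<in> diagram p} = {j. (i, j) \<in> diagram q}" by simp
  then have "{..<p i} = {..<q i}" by (simp add: diagram_def lessThan_def)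
  then show "p i = q i" by simp
qed

lemma ideal_bounded: "order_ideal D \<Longrightarrow> \<exists>N. D \<subseteq> {..<N} \<times> {..<N}"
proof -
  assume "order_ideal D"
  then have "finite (fst ` D \<union> snd ` D)" using idealD by blast
  then obtain N where "\<forall>n \<in> fst ` D \<union> snd ` D. n < N" using finite_nat_set_iff_bounded by blast
  then show ?thesis by (intro exI[of _ N]) force
qed

section \<open>Chains of order ideals\<close>

lemma grows_idealD: "grows D bs E \<Longrightarrow> order_ideal D" "grows D bs E \<Longrightarrow> order_ideal E"
  by (induction bs arbitrary: D) auto

lemma grows_append: "grows D (as @ bs) E \<longleftrightarrow> (\<exists>F. grows D as F \<and> grows F bs E)"
  by (induction as arbitrary: D) (auto dest: grows_idealD)

lemma grows_set: "grows D bs E \<Longrightarrow> E = D \<union> set bs \<and> D \<inter> set bs = {} \<and> distinct bs"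
  by (induction bs arbitrary: D) auto

lemma grows_take: "grows D bs E \<Longrightarrow> order_ideal (D \<union> set (take m bs))"
  by (metis append_take_drop_id grows_append grows_idealD(1) grows_set)

text \<open>This is standardness: \<open>D\<close> with any prefix of the list is an ideal, so a box
  to the northwest of an added box, if not in \<open>D\<close>, has been added before it.\<close>

lemma grows_less:
  assumes "grows D bs E" "q < length bs" "bs ! q = (i, j)" "p < length bs" "bs ! p = (i', j')"
    "i' \<le> i" "j' \<le> j" "p \<noteq> q"
  shows "p < q"
proof -
  have d: "distinct bs" "D \<inter> set bs = {}" using grows_set[OF assms(1)] by auto
  have "(i, j) \<in> D \<union> set (take (Suc q) bs)"
    using assms(2,3) by (auto simp: take_Suc_conv_app_nth)
  then have "(i', j') \<in> D \<union> set (take (Suc q) bs)"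
    using ideal_le[OF grows_take[OF assms(1)]] assms(6,7) by blast
  moreover have "(i', j') \<notin> D" using d(2) assms(4,5) nth_mem by fastforce
  ultimately obtain r where r: "r \<le> q" "bs ! r = (i', j')" "r < length bs"
    by (auto simp: in_set_conv_nth less_Suc_eq_le)
  then have "r = p" using d(1) assms(4,5) nth_eq_iff_index_eq by metis
  then show ?thesis using r assms(8) by simp
qed

lemma grows_less_nth:
  assumes "grows D bs E" "p < length bs" "q < length bs" "p \<noteq> q"
    "fst (bs ! p) \<le> fst (bs ! q)" "snd (bs ! p) \<le> snd (bs ! q)"
  shows "p < q"
  by (rule grows_less[OF assms(1,3) _ assms(2) _ assms(5,6,4)]) simp_all

text \<open>Checking neighbours suffices: no box still to come is an immediate predecessor of the
  head, and the final set is an ideal, so \<open>D\<close> with the head is an ideal too.\<close>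

lemma growsI:
  assumes "order_ideal D" "distinct bs" "D \<inter> set bs = {}" "order_ideal (D \<union> set bs)"
    and "\<And>p q. p < length bs \<Longrightarrow> q < length bs \<Longrightarrow> adj (bs ! p) (bs ! q) \<Longrightarrow> p < q"
  shows "grows D bs (D \<union> set bs)"
  using assms
proof (induction bs arbitrary: D)
  case (Cons b bs)
  have no: "\<not> adj x b" if x: "x \<in> set bs" for x
  proof
    assume a: "adj x b"
    from x obtain p where "p < length bs" "x = bs ! p" by (auto simp: in_set_conv_nth)
    then show False using a Cons.prems(5)[of "Suc p" 0] by simp
  qed
  have "order_ideal (insert b D)"
    unfolding order_ideal_def
  proof (intro conjI allI impI)
    show "finite (insert b D)" using Cons.prems(1) by (auto simp: order_ideal_def)
    fix i j
    { assume "(Suc i, j) \<in> insert b D"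
      moreover from this have "(i, j) \<in> insert b D \<union> set bs"
        using idealD(2,3)[OF Cons.prems(4), of i j] by auto
      moreover have "adj (i, j) (Suc i, j)" by (simp add: adj_def)
      ultimately show "(i, j) \<in> insert b D"
        using idealD(2,3)[OF Cons.prems(1), of i j] no[of "(i, j)"] by auto }
    { assume "(i, Suc j) \<in> insert b D"
      moreover from this have "(i, j) \<in> insert b D \<union> set bs"
        using idealD(2,3)[OF Cons.prems(4), of i j] by auto
      moreover have "adj (i, j) (i, Suc j)" by (simp add: adj_def)
      ultimately show "(i, j) \<in> insert b D"
        using idealD(2,3)[OF Cons.prems(1), of i j] no[of "(i, j)"] by auto }
  qed
  moreover have "p < q" if "p < length bs" "q < length bs" "adj (bs ! p) (bs ! q)" for p q
    using Cons.prems(5)[of "Suc p" "Suc q"] that by simp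
  moreover have "distinct bs" "insert b D \<inter> set bs = {}" "order_ideal (insert b D \<union> set bs)"
    using Cons.prems(2,3,4) by auto
  ultimately have "grows (insert b D) bs (insert b D \<union> set bs)"
    by (intro Cons.IH) blast+
  then show ?case using Cons.prems(1,3) by simp
qed simp

text \<open>
  A box \<open>b\<close> meeting the hole \<open>h\<close>: if \<open>b\<close> is adjacent, its entry moves into \<open>h\<close> and the hole moves
  to \<open>b\<close>; the result is the new box of the entry and the new hole. As slides compare entries, moving
  the entries in increasing order past the hole performs the slide.
\<close>

definition exchange :: "nat \<times> nat \<Rightarrow> nat \<times> nat \<Rightarrow> (nat \<times> nat) \<times> (nat \<times> nat)" where
  "exchange h b = (if adj h b then (h, b) else (b, h))"

fun slide_list :: "nat \<times> nat \<Rightarrow> (nat \<times> nat) list \<Rightarrow> (nat \<times> nat) list \<times> (nat \<times> nat)" where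
  "slide_list h [] = ([], h)"
| "slide_list h (b # bs) =
    (let (b', h') = exchange h b; (bs', h'') = slide_list h' bs in (b' # bs', h''))"

fun pass :: "(nat \<times> nat) list \<Rightarrow> nat \<times> nat \<Rightarrow> (nat \<times> nat) \<times> (nat \<times> nat) list" where
  "pass [] b = (b, [])"
| "pass (c # cs) b =
    (let (b', cs') = pass cs b; (b'', c') = exchange c b' in (b'', c' # cs'))"

fun switch :: "(nat \<times> nat) list \<Rightarrow> (nat \<times> nat) list \<Rightarrow> (nat \<times> nat) list \<times> (nat \<times> nat) list" where
  "switch [] bs = (bs, [])"
| "switch (c # cs) bs =
    (let (bs', cs') = switch cs bs; (bs'', c') = slide_list c bs' in (bs'', c' # cs'))"

text \<open>The two boxes are swapped exactly when adding them in the other order also gives ideals,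
  which fails only if \<open>b\<close> is adjacent to \<open>h\<close>. The rule is an involution
  because \<open>adj b h\<close> cannot hold: it would force \<open>b\<close> into the ideal
  \<open>insert h D\<close>.\<close>

lemma exchange_grows:
  assumes "grows D (h # b # bs) E" "exchange h b = (b', h')"
  shows "grows D (b' # h' # bs) E" "exchange b' h' = (h, b)"
proof -
  have a: "order_ideal D" "order_ideal (insert h D)" "order_ideal (insert b (insert h D))" "h \<noteq> b" "h \<notin> D" "b \<notin> D"
    using assms(1) by (auto dest: grows_idealD)
  have "\<not> adj b h"
  proof
    obtain i j where b: "b = (i, j)" by (cases b) blast
    assume "adj b h"
    then have "h = (Suc i, j) \<or> h = (i, Suc j)" by (simp add: adj_def b)
    then have "b \<in> insert h D" using a(2) unfolding order_ideal_def b by blast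
    then show False using a by auto
  qed
  moreover have "order_ideal (insert b D)" if n: "\<not> adj h b"
    unfolding order_ideal_def
  proof (intro conjI allI impI)
    show "finite (insert b D)" using a(1) by (auto simp: order_ideal_def)
    fix i j
    { assume *: "(Suc i, j) \<in> insert b D"
      have "(i, j) \<in> insert b (insert h D)" using * a(3) unfolding order_ideal_def by blast
      moreover have "(i, j) \<noteq> h"
      proof
        assume h: "(i, j) = h"
        then have "(Suc i, j) \<in> D" using * n by (auto simp: adj_def)
        then have "(i, j) \<in> D" using a(1) unfolding order_ideal_def by blast
        then show False using h a(5) by simp
      qed
      ultimately show "(i, j) \<in> insert b D" by simp }
    { assume *: "(i, Suc j) \<in> insert b D"
      have "(i, j) \<in> insert b (insert h D)" using * a(3) unfolding order_ideal_def by blast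
      moreover have "(i, j) \<noteq> h"
      proof
        assume h: "(i, j) = h"
        then have "(i, Suc j) \<in> D" using * n by (auto simp: adj_def)
        then have "(i, j) \<in> D" using a(1) unfolding order_ideal_def by blast
        then show False using h a(5) by simp
      qed
      ultimately show "(i, j) \<in> insert b D" by simp }
  qed
  moreover have "insert h (insert b D) = insert b (insert h D)" by auto
  ultimately show "grows D (b' # h' # bs) E" "exchange b' h' = (h, b)"
    using assms a by (simp_all add: exchange_def split: if_splits)
qed

text \<open>In the chain the hole travels from the first place to the last; \<open>pass\<close>
  carries it back through the same exchanges, each of which is an involution.\<close>

lemma slide_list_grows:
  assumes "grows D (h # bs) E" "slide_list h bs = (bs', h')"
  shows "grows D (bs' @ [h']) E \<and> length bs' = length bs \<and> pass bs' h' = (h, bs)"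
  using assms
proof (induction bs arbitrary: D h bs' h')
  case (Cons b bs)
  obtain b1 h1 where e: "exchange h b = (b1, h1)" by (cases "exchange h b") blast
  obtain bs1 h2 where s: "slide_list h1 bs = (bs1, h2)" by (cases "slide_list h1 bs") blast
  have r: "bs' = b1 # bs1" "h' = h2" using Cons.prems(2) e s by auto
  note g = exchange_grows[OF Cons.prems(1) e]
  have g1: "grows (insert b1 D) (h1 # bs) E" "order_ideal D" "b1 \<notin> D" using g(1) by (auto dest: grows_idealD)
  show ?case using Cons.IH[OF g1(1) s] g1(2,3) g(2) r by simp
qed auto

lemma switch_Nil2: "switch cs [] = ([], cs)"
  by (induction cs) auto

text \<open>
  The exchanges form a rectangular array, which \<open>switch\<close> traverses by rows and \<open>pass\<close> by columns.
\<close>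

lemma switch_Cons2:
  "switch cs (b # bs) = (let (b', cs') = pass cs b; (bs', cs'') = switch cs' bs in (b' # bs', cs''))"
  by (induction cs) (simp_all add: case_prod_beta Let_def)

lemma switch_grows:
  assumes "grows D (cs @ bs) E" "switch cs bs = (bs', cs')"
  shows "grows D (bs' @ cs') E \<and> length bs' = length bs \<and> length cs' = length cs \<and>
    switch bs' cs' = (cs, bs)"
  using assms
proof (induction cs arbitrary: D bs' cs')
  case Nil
  then show ?case by (auto simp: switch_Nil2)
next
  case (Cons c cs)
  obtain bs1 cs1 where s: "switch cs bs = (bs1, cs1)" by (cases "switch cs bs") blast
  obtain bs2 c2 where l: "slide_list c bs1 = (bs2, c2)" by (cases "slide_list c bs1") blast
  have r: "bs' = bs2" "cs' = c2 # cs1" using Cons.prems s l by auto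
  have g: "grows (insert c D) (cs @ bs) E" "order_ideal D" "c \<notin> D" using Cons.prems by auto
  note IH = Cons.IH[OF g(1) s]
  obtain F where F: "grows (insert c D) bs1 F" "grows F cs1 E" using IH by (auto simp: grows_append)
  have "grows D (c # bs1) F" using F g by simp
  note L = slide_list_grows[OF this l]
  have "grows D ((bs2 @ [c2]) @ cs1) E" using L F by (auto simp only: grows_append)
  \<comment> \<open>The inverse is read by columns: \<open>switch_Cons2\<close> splits off
    \<open>c2\<close>, \<open>pass\<close> undoes the slide of \<open>c\<close>, and the induction
    hypothesis undoes the rest.\<close>
  then show ?case using L IH r by (simp add: switch_Cons2)
qed

section \<open>Knuth equivalence\<close>

text \<open>The words are words of labels, which do not repeat, hence the strict inequalities. The
  degree conditions of the super plactic relations return through \<open>consistent\<close>.\<close>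

inductive knuth_step :: "nat list \<Rightarrow> nat list \<Rightarrow> bool" where
  xzy: "x < y \<Longrightarrow> y < z \<Longrightarrow> knuth_step (u @ [x, z, y] @ v) (u @ [z, x, y] @ v)"
| yxz: "x < y \<Longrightarrow> y < z \<Longrightarrow> knuth_step (u @ [y, x, z] @ v) (u @ [y, z, x] @ v)"

abbreviation knuth :: "nat list \<Rightarrow> nat list \<Rightarrow> bool" where
  "knuth \<equiv> equivclp knuth_step"

lemma knuth_step_context: "knuth_step w w' \<Longrightarrow> knuth_step (p @ w @ s) (p @ w' @ s)"
proof (induction rule: knuth_step.induct)
  case (xzy x y z u v)
  then show ?case using knuth_step.xzy[of x y z "p @ u" "v @ s"] by simp
next
  case (yxz x y z u v)
  then show ?case using knuth_step.yxz[of x y z "p @ u" "v @ s"] by simp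
qed

lemma knuth_context: "knuth w w' \<Longrightarrow> knuth (p @ w @ s) (p @ w' @ s)"
  by (induction rule: equivclp_induct)
    (auto intro: equivclp_trans r_into_equivclp equivclp_sym dest: knuth_step_context)

lemma knuth_Cons: "knuth w w' \<Longrightarrow> knuth (a # w) (a # w')"
  using knuth_context[of w w' "[a]" "[]"] by simp

text \<open>First half of a row insertion: \<open>y\<close> moves left past the entries to the right
  of the bumped \<open>b\<close>. Each commutation is licensed by the left neighbour, which lies
  between \<open>y\<close> and the entry being passed.\<close>

lemma knuth_bump_right:
  assumes "sorted_wrt (<) (b # c)" "y < b"
  shows "knuth (b # c @ [y]) (b # y # c)"
  using assms
proof (induction c arbitrary: b)
  case (Cons d c)
  have "knuth (b # d # c @ [y]) (b # d # y # c)"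
    using knuth_Cons[OF Cons.IH[of d]] Cons.prems by auto
  also have "knuth \<dots> (b # y # d # c)"
    using knuth_step.yxz[of y b d "[]" c] Cons.prems
    by (intro equivclp_sym[OF r_into_equivclp]) auto
  finally (equivclp_trans) show ?case by simp
qed simp

text \<open>Second half of a row insertion: the bumped \<open>b\<close> moves to the front. Each
  commutation is licensed by the next entry of the row, which lies between the entry being passed
  and \<open>b\<close>.\<close>

lemma knuth_bump_left:
  assumes "sorted_wrt (<) (a @ [y])" "y < b"
  shows "knuth (a @ [b, y]) (b # a @ [y])"
  using assms
proof (induction a)
  case (Cons d a)
  have "knuth (d # a @ [b, y]) (d # b # a @ [y])"
    using Cons by (intro knuth_Cons) auto
  also have "knuth \<dots> (b # d # a @ [y])"
  proof -
    obtain e r where e: "a @ [y] = e # r" by (cases "a @ [y]") auto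
    then have "d < e" "e < b" using Cons.prems by (auto simp: sorted_wrt_append) (cases a, auto)+
    then show ?thesis using knuth_step.xzy[of d e b "[]" r] e by (auto intro: r_into_equivclp)
  qed
  finally (equivclp_trans) show ?case by simp
qed simp

lemma knuth_bump:
  assumes "sorted_wrt (<) (a @ [y])" "sorted_wrt (<) (b # c)" "y < b"
  shows "knuth (a @ b # c @ [y]) (b # a @ y # c)"
proof -
  have "knuth (a @ b # c @ [y]) (a @ b # y # c)"
    using knuth_context[OF knuth_bump_right[OF assms(2,3)], of a "[]"] by simp
  also have "knuth \<dots> (b # a @ y # c)"
    using knuth_context[OF knuth_bump_left[OF assms(1,3)], of "[]" c] by simp
  finally (equivclp_trans) show ?thesis .
qed

text \<open>The letters of \<open>us\<close> are inserted one after another, each bumping its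
  partner in \<open>us'\<close> and then belonging to the small part \<open>a\<close> for the next
  insertion.\<close>

lemma knuth_bumps:
  assumes "list_all2 (<) us us'" "sorted_wrt (<) (a @ us)" "sorted_wrt (<) (us' @ c)"
  shows "knuth (a @ us' @ c @ us) (us' @ a @ us @ c)"
  using assms
proof (induction us us' arbitrary: a rule: list_all2_induct)
  case (Cons u us u' us')
  have "knuth (a @ (u' # us' @ c) @ u # us) (u' # a @ u # us' @ c @ us)"
    using knuth_context[OF knuth_bump[of a u u' "us' @ c"], of "[]" us] Cons
    by (auto simp: sorted_wrt_append)
  also have "knuth \<dots> (u' # us' @ (a @ [u]) @ us @ c)"
    using Cons.IH[of "a @ [u]"] Cons.prems by (intro knuth_Cons) auto
  finally (equivclp_trans) show ?case by simp
qed auto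

text \<open>
  The lower row \<open>u' x v'\<close> and the upper row \<open>u v\<close> with its hole above \<open>x\<close>; the entry \<open>x\<close> moves up.
  Both words arise from one another by row insertion of \<open>u\<close> and of \<open>v\<close>.
\<close>

lemma knuth_vertical:
  assumes "list_all2 (<) u u'" "list_all2 (<) v v'"
    "sorted_wrt (<) (u' @ x # v')" "sorted_wrt (<) (u @ x # v)"
  shows "knuth (u' @ x # v' @ u @ v) (u' @ v' @ u @ x # v)"
proof -
  have "knuth (u' @ x # v' @ u @ v) (u' @ (u @ [x]) @ v' @ v)"
    using knuth_context[OF knuth_bumps[of u u' "[]" "x # v'"], of "[]" v] assms
    by (simp add: sorted_wrt_append)
  also have "knuth \<dots> (u' @ v' @ u @ x # v)"
    using knuth_context[OF knuth_bumps[of v v' "u @ [x]" "[]"], of u' "[]"] assms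
    by (simp add: sorted_wrt_append)
  finally (equivclp_trans) show ?thesis .
qed

lemma knuth_mset: "knuth w w' \<Longrightarrow> mset w' = mset w"
proof (induction rule: equivclp_induct)
  case (step y z)
  have "mset w' = mset w" if "knuth_step w w'" for w w'
    using that by (induction rule: knuth_step.induct) simp_all
  then show ?case using step by metis
qed simp

text \<open>If the largest letter \<open>z\<close> of a Knuth relation is erased, both sides become
  equal; otherwise all three letters survive.\<close>

lemma knuth_filter_less: "knuth w w' \<Longrightarrow> knuth (filter (\<lambda>a. a < m) w) (filter (\<lambda>a. a < m) w')"
proof (induction rule: equivclp_induct)
  case (step y z)
  have "knuth (filter (\<lambda>a. a < m) y) (filter (\<lambda>a. a < m) z)" if "knuth_step y z" for y z
    using that
  proof cases
    case (xzy x y z u v)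
    then show ?thesis
      using knuth_step.xzy[of x y z "filter (\<lambda>a. a < m) u" "filter (\<lambda>a. a < m) v"]
      by (auto intro: r_into_equivclp)
  next
    case (yxz x y z u v)
    then show ?thesis
      using knuth_step.yxz[of x y z "filter (\<lambda>a. a < m) u" "filter (\<lambda>a. a < m) v"]
      by (auto intro: r_into_equivclp)
  qed
  then show ?case using step by (meson equivclp_sym equivclp_trans)
qed simp

text \<open>
  The Greene invariant: the largest size of a set of letters without a decreasing subsequence of
  length \<open>k + 1\<close> is constant on Knuth classes, and for a tableau it is the number of boxes in the
  first \<open>k\<close> rows.
\<close>

definition dec_bounded :: "nat \<Rightarrow> nat set \<Rightarrow> nat list \<Rightarrow> bool" where
  "dec_bounded k S w \<longleftrightarrow> (\<forall>C. subseq C w \<and> sorted_wrt (>) C \<and> set C \<subseteq> S \<longrightarrow> length C \<le> k)"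


lemma dec_boundedD:
  assumes "dec_bounded k S (u @ P @ v)" "subseq A u" "subseq M P" "subseq B v"
    "sorted_wrt (>) (A @ M @ B)" "set (A @ M @ B) \<subseteq> S"
  shows "length A + length M + length B \<le> k"
proof -
  have "subseq (A @ M @ B) (u @ P @ v)" using assms(2-4) by (intro list_emb_append_mono)
  then have "length (A @ M @ B) \<le> k" using assms(1,5,6) unfolding dec_bounded_def by blast
  then show ?thesis by simp
qed

lemma not_dec_boundedE:
  assumes "\<not> dec_bounded k S (u @ P @ v)"
  obtains A M B where "subseq A u" "subseq M P" "subseq B v" "sorted_wrt (>) (A @ M @ B)"
    "set (A @ M @ B) \<subseteq> S" "length A + length M + length B > k"
proof -
  obtain C where C: "subseq C (u @ P @ v)" "sorted_wrt (>) C" "set C \<subseteq> S" "\<not> length C \<le> k"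
    using assms by (auto simp: dec_bounded_def)
  then obtain A M B where "C = A @ M @ B" "subseq A u" "subseq M P" "subseq B v"
    by (metis subseq_appendE)
  then show thesis using C that[of A M B] by simp
qed

lemma subseq_3_cases:
  assumes "subseq M [a, b, c :: nat]"
  shows "M = [] \<or> M = [a] \<or> M = [b] \<or> M = [c] \<or> M = [a, b] \<or> M = [a, c] \<or> M = [b, c] \<or> M = [a, b, c]"
  using assms unfolding in_set_subseqs[symmetric] by (auto simp: Let_def)

text \<open>Every decreasing subsequence of the left-hand triple also occurs in the right-hand one,
  so in this direction \<open>S\<close> can be kept. The other direction creates the pair
  \<open>z\<close>, \<open>x\<close> and requires changing \<open>S\<close>.\<close>

lemma dec_bounded_knuth_step_back:
  assumes "knuth_step w w'" "dec_bounded k S w'"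
  shows "dec_bounded k S w"
proof (rule ccontr)
  assume n: "\<not> dec_bounded k S w"
  from assms(1) show False
  proof cases
    case (xzy x y z u v)
    obtain A M B where *: "subseq A u" "subseq M [x, z, y]" "subseq B v" "sorted_wrt (>) (A @ M @ B)"
      "set (A @ M @ B) \<subseteq> S" "length A + length M + length B > k"
      using n unfolding xzy(1) by (rule not_dec_boundedE)
    have "subseq M [z, x, y]"
      using subseq_3_cases[OF *(2)] *(4) xzy(3,4) by (auto simp: sorted_wrt_append)
    from dec_boundedD[OF assms(2)[unfolded xzy(2)] *(1) this *(3-5)] *(6) show False by simp
  next
    case (yxz x y z u v)
    obtain A M B where *: "subseq A u" "subseq M [y, x, z]" "subseq B v" "sorted_wrt (>) (A @ M @ B)"
      "set (A @ M @ B) \<subseteq> S" "length A + length M + length B > k"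
      using n unfolding yxz(1) by (rule not_dec_boundedE)
    have "subseq M [y, z, x]"
      using subseq_3_cases[OF *(2)] *(4) yxz(3,4) by (auto simp: sorted_wrt_append)
    from dec_boundedD[OF assms(2)[unfolded yxz(2)] *(1) this *(3-5)] *(6) show False by simp
  qed
qed

lemma subseq_set: "subseq xs ys \<Longrightarrow> set xs \<subseteq> set ys"
  by (auto dest: list_emb_set)

lemma sorted_pivot:
  fixes p :: nat
  assumes "sorted_wrt (>) A" "sorted_wrt (>) B" "\<And>a. a \<in> set A \<Longrightarrow> p < a" "\<And>b. b \<in> set B \<Longrightarrow> b < p"
  shows "sorted_wrt (>) (A @ [p] @ B)" "sorted_wrt (>) (A @ [] @ B)"
  using assms by (auto simp: sorted_wrt_append intro: less_trans)

text \<open>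
  The only new decreasing pair is \<open>z x\<close>. If it creates a long chain \<open>A z x B\<close> in \<open>S\<close>, then
  \<open>y \<notin> S\<close>, and replacing \<open>x\<close> or \<open>z\<close> by \<open>y\<close> works: long chains \<open>A1 y B1\<close> and \<open>A2 y B2\<close> for both
  replacements could be recombined to chains \<open>A z B1\<close>, \<open>A2 x B\<close> and \<open>A1 B2\<close> of the original word,
  with too large a total length.
\<close>

lemma dec_bounded_knuth_step_xzy:
  assumes lt: "x < y" "y < z" and d: "distinct (u @ [x, z, y] @ v)"
    and S: "S \<subseteq> set (u @ [x, z, y] @ v)" and g: "dec_bounded k S (u @ [x, z, y] @ v)"
  shows "\<exists>S' \<subseteq> set (u @ [x, z, y] @ v). card S' = card S \<and> dec_bounded k S' (u @ [z, x, y] @ v)"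
proof (cases "dec_bounded k S (u @ [z, x, y] @ v)")
  case False
  then obtain A M B where C: "subseq A u" "subseq M [z, x, y]" "subseq B v"
    "sorted_wrt (>) (A @ M @ B)" "set (A @ M @ B) \<subseteq> S" "length A + length M + length B > k"
    by (rule not_dec_boundedE)
  have "\<not> subseq M [x, z, y]" using dec_boundedD[OF g C(1) _ C(3-5)] C(6) by auto
  then have M: "M = [z, x]" using subseq_3_cases[OF C(2)] C(4) lt by (auto simp: sorted_wrt_append)
  \<comment> \<open>Otherwise \<open>A\<close>, \<open>z\<close>, \<open>y\<close>, \<open>B\<close>
    would be an equally long chain of the original word.\<close>
  have y: "y \<notin> S"
  proof
    assume "y \<in> S"
    then have "length A + length [z, y] + length B \<le> k"
      using C lt unfolding M by (intro dec_boundedD[OF g C(1) _ C(3)]) (auto simp: sorted_wrt_append)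
    then show False using C(6) M by simp
  qed
  let ?S1 = "insert y (S - {x})" and ?S2 = "insert y (S - {z})"
  have fin: "finite S" using S finite_subset by blast
  have xz: "x \<in> S" "z \<in> S" using C(5) M by auto
  have card: "card ?S1 = card S" "card ?S2 = card S"
    using card_Suc_Diff1[OF fin xz(1)] card_Suc_Diff1[OF fin xz(2)] fin y
    by (simp_all del: card_Diff_singleton card_Diff_insert)
  have sub: "?S1 \<subseteq> set (u @ [x, z, y] @ v)" "?S2 \<subseteq> set (u @ [x, z, y] @ v)" using S by auto
  have "dec_bounded k ?S1 (u @ [z, x, y] @ v) \<or> dec_bounded k ?S2 (u @ [z, x, y] @ v)"
  proof (rule ccontr)
    assume n: "\<not> ?thesis"
    then have n1: "\<not> dec_bounded k ?S1 (u @ [z, x, y] @ v)" and n2: "\<not> dec_bounded k ?S2 (u @ [z, x, y] @ v)" by auto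
    from n1 obtain A1 M1 B1 where C1: "subseq A1 u" "subseq M1 [z, x, y]" "subseq B1 v"
      "sorted_wrt (>) (A1 @ M1 @ B1)" "set (A1 @ M1 @ B1) \<subseteq> ?S1"
      "length A1 + length M1 + length B1 > k" by (rule not_dec_boundedE)
    from n2 obtain A2 M2 B2 where C2: "subseq A2 u" "subseq M2 [z, x, y]" "subseq B2 v"
      "sorted_wrt (>) (A2 @ M2 @ B2)" "set (A2 @ M2 @ B2) \<subseteq> ?S2"
      "length A2 + length M2 + length B2 > k" by (rule not_dec_boundedE)
    note ss = subseq_set[OF C1(1)] subseq_set[OF C1(3)] subseq_set[OF C2(1)] subseq_set[OF C2(3)]
    have inS: "set A1 \<subseteq> S" "set B1 \<subseteq> S" "set A2 \<subseteq> S" "set B2 \<subseteq> S"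
      using C1(5) C2(5) ss d by auto
    have "y \<in> set M1"
    proof (rule ccontr)
      assume "y \<notin> set M1"
      moreover from this have "subseq M1 [x, z, y]"
        using subseq_3_cases[OF C1(2)] C1(5) lt by auto
      ultimately have "length A1 + length M1 + length B1 \<le> k"
        using C1 inS by (intro dec_boundedD[OF g C1(1) _ C1(3)]) auto
      then show False using C1(6) by simp
    qed
    then have M1: "M1 = [y] \<or> M1 = [z, y]"
      using subseq_3_cases[OF C1(2)] C1(4) lt by (auto simp: sorted_wrt_append)
    have "y \<in> set M2"
    proof (rule ccontr)
      assume "y \<notin> set M2"
      moreover from this have "subseq M2 [x, z, y]"
        using subseq_3_cases[OF C2(2)] C2(5) lt by auto
      ultimately have "length A2 + length M2 + length B2 \<le> k"
        using C2 inS by (intro dec_boundedD[OF g C2(1) _ C2(3)]) auto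
      then show False using C2(6) by simp
    qed
    then have M2: "M2 = [y]"
      using subseq_3_cases[OF C2(2)] C2(4,5) lt by (auto simp: sorted_wrt_append)
    have ord: "a \<in> set A \<Longrightarrow> z < a" "b \<in> set B \<Longrightarrow> b < x" "a \<in> set A1 \<Longrightarrow> y < a"
      "b \<in> set B1 \<Longrightarrow> b < y" "a \<in> set A2 \<Longrightarrow> y < a" "b \<in> set B2 \<Longrightarrow> b < y" for a b
      using C(4) C1(4) C2(4) M M1 M2 by (auto simp: sorted_wrt_append)
    have srt: "sorted_wrt (>) A" "sorted_wrt (>) B" "sorted_wrt (>) A1" "sorted_wrt (>) B1"
      "sorted_wrt (>) A2" "sorted_wrt (>) B2"
      using C(4) C1(4) C2(4) by (auto simp: sorted_wrt_append)
    have subS: "set A \<subseteq> S" "set B \<subseteq> S" using C(5) by auto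
    have 1: "length A + length [z] + length B1 \<le> k"
    proof (rule dec_boundedD[OF g C(1) _ C1(3)])
      show "sorted_wrt (>) (A @ [z] @ B1)"
        by (rule sorted_pivot[OF srt(1,4)]) (use ord(1,4) lt less_trans in blast)+
    qed (use inS subS xz in auto)
    have 2: "length A2 + length [x] + length B \<le> k"
    proof (rule dec_boundedD[OF g C2(1) _ C(3)])
      show "sorted_wrt (>) (A2 @ [x] @ B)"
        by (rule sorted_pivot[OF srt(5,2)]) (use ord(5,2) lt less_trans in blast)+
    qed (use inS subS xz in auto)
    have 3: "length A1 + length ([] :: nat list) + length B2 \<le> k"
    proof (rule dec_boundedD[OF g C1(1) _ C2(3)])
      show "sorted_wrt (>) (A1 @ [] @ B2)"
        by (rule sorted_pivot[OF srt(3,6)]) (use ord(3,6) in blast)+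
    qed (use inS in auto)
    \<comment> \<open>When the chain through \<open>y\<close> also contains \<open>z\<close>, it
      supplies one letter less to \<open>A1\<close> and \<open>B1\<close>; the bound 3 is sharpened
      by keeping \<open>z\<close> to make up for it.\<close>
    have 4: "length A1 + length [z] + length B2 \<le> k" if M1: "M1 = [z, y]"
    proof (rule dec_boundedD[OF g C1(1) _ C2(3)])
      have "a \<in> set A1 \<Longrightarrow> z < a" for a using M1 C1(4) by (auto simp: sorted_wrt_append)
      then show "sorted_wrt (>) (A1 @ [z] @ B2)"
        by (rule sorted_pivot[OF srt(3,6)]) (use ord(6) lt less_trans in blast)+
    qed (use inS xz in auto)
    \<comment> \<open>For \<open>M1 = [y]\<close> the six outer pieces have total length at least 3k
      - 1 by the three long chains and at most 3k - 2 by 1, 2 and 3. For \<open>M1 = [z, y]\<close>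
      both bounds drop by one, with 4 in place of 3.\<close>
    show False using M1 M2 1 2 3 4 C(6) C1(6) C2(6) M by auto
  qed
  then show ?thesis using card sub by blast
qed (use S in blast)

text \<open>The same recombination with \<open>y\<close> in front of the pair: now it is the chain
  for \<open>?S2\<close> that may continue past \<open>y\<close>, namely to \<open>x\<close>, and 4
  keeps this \<open>x\<close>.\<close>

lemma dec_bounded_knuth_step_yxz:
  assumes lt: "x < y" "y < z" and d: "distinct (u @ [y, x, z] @ v)"
    and S: "S \<subseteq> set (u @ [y, x, z] @ v)" and g: "dec_bounded k S (u @ [y, x, z] @ v)"
  shows "\<exists>S' \<subseteq> set (u @ [y, x, z] @ v). card S' = card S \<and> dec_bounded k S' (u @ [y, z, x] @ v)"
proof (cases "dec_bounded k S (u @ [y, z, x] @ v)")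
  case False
  then obtain A M B where C: "subseq A u" "subseq M [y, z, x]" "subseq B v"
    "sorted_wrt (>) (A @ M @ B)" "set (A @ M @ B) \<subseteq> S" "length A + length M + length B > k"
    by (rule not_dec_boundedE)
  have "\<not> subseq M [y, x, z]" using dec_boundedD[OF g C(1) _ C(3-5)] C(6) by auto
  then have M: "M = [z, x]" using subseq_3_cases[OF C(2)] C(4) lt by (auto simp: sorted_wrt_append)
  have y: "y \<notin> S"
  proof
    assume "y \<in> S"
    then have "length A + length [y, x] + length B \<le> k"
      using C lt unfolding M by (intro dec_boundedD[OF g C(1) _ C(3)]) (auto simp: sorted_wrt_append)
    then show False using C(6) M by simp
  qed
  let ?S1 = "insert y (S - {x})" and ?S2 = "insert y (S - {z})"
  have fin: "finite S" using S finite_subset by blast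
  have xz: "x \<in> S" "z \<in> S" using C(5) M by auto
  have card: "card ?S1 = card S" "card ?S2 = card S"
    using card_Suc_Diff1[OF fin xz(1)] card_Suc_Diff1[OF fin xz(2)] fin y
    by (simp_all del: card_Diff_singleton card_Diff_insert)
  have sub: "?S1 \<subseteq> set (u @ [y, x, z] @ v)" "?S2 \<subseteq> set (u @ [y, x, z] @ v)" using S by auto
  have "dec_bounded k ?S1 (u @ [y, z, x] @ v) \<or> dec_bounded k ?S2 (u @ [y, z, x] @ v)"
  proof (rule ccontr)
    assume n: "\<not> ?thesis"
    then have n1: "\<not> dec_bounded k ?S1 (u @ [y, z, x] @ v)" and n2: "\<not> dec_bounded k ?S2 (u @ [y, z, x] @ v)" by auto
    from n1 obtain A1 M1 B1 where C1: "subseq A1 u" "subseq M1 [y, z, x]" "subseq B1 v"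
      "sorted_wrt (>) (A1 @ M1 @ B1)" "set (A1 @ M1 @ B1) \<subseteq> ?S1"
      "length A1 + length M1 + length B1 > k" by (rule not_dec_boundedE)
    from n2 obtain A2 M2 B2 where C2: "subseq A2 u" "subseq M2 [y, z, x]" "subseq B2 v"
      "sorted_wrt (>) (A2 @ M2 @ B2)" "set (A2 @ M2 @ B2) \<subseteq> ?S2"
      "length A2 + length M2 + length B2 > k" by (rule not_dec_boundedE)
    note ss = subseq_set[OF C1(1)] subseq_set[OF C1(3)] subseq_set[OF C2(1)] subseq_set[OF C2(3)]
    have inS: "set A1 \<subseteq> S" "set B1 \<subseteq> S" "set A2 \<subseteq> S" "set B2 \<subseteq> S"
      using C1(5) C2(5) ss d by auto
    have "y \<in> set M1"
    proof (rule ccontr)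
      assume "y \<notin> set M1"
      moreover from this have "subseq M1 [y, x, z]"
        using subseq_3_cases[OF C1(2)] C1(5) lt by auto
      ultimately have "length A1 + length M1 + length B1 \<le> k"
        using C1 inS by (intro dec_boundedD[OF g C1(1) _ C1(3)]) auto
      then show False using C1(6) by simp
    qed
    then have M1: "M1 = [y]"
      using subseq_3_cases[OF C1(2)] C1(4,5) lt by (auto simp: sorted_wrt_append)
    have "y \<in> set M2"
    proof (rule ccontr)
      assume "y \<notin> set M2"
      moreover from this have "subseq M2 [y, x, z]"
        using subseq_3_cases[OF C2(2)] C2(5) lt by auto
      ultimately have "length A2 + length M2 + length B2 \<le> k"
        using C2 inS by (intro dec_boundedD[OF g C2(1) _ C2(3)]) auto
      then show False using C2(6) by simp
    qed
    then have M2: "M2 = [y] \<or> M2 = [y, x]"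
      using subseq_3_cases[OF C2(2)] C2(4,5) lt by (auto simp: sorted_wrt_append)
    have ord: "a \<in> set A \<Longrightarrow> z < a" "b \<in> set B \<Longrightarrow> b < x" "a \<in> set A1 \<Longrightarrow> y < a"
      "b \<in> set B1 \<Longrightarrow> b < y" "a \<in> set A2 \<Longrightarrow> y < a" "b \<in> set B2 \<Longrightarrow> b < y" for a b
      using C(4) C1(4) C2(4) M M1 M2 by (auto simp: sorted_wrt_append)
    have srt: "sorted_wrt (>) A" "sorted_wrt (>) B" "sorted_wrt (>) A1" "sorted_wrt (>) B1"
      "sorted_wrt (>) A2" "sorted_wrt (>) B2"
      using C(4) C1(4) C2(4) by (auto simp: sorted_wrt_append)
    have subS: "set A \<subseteq> S" "set B \<subseteq> S" using C(5) by auto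
    have 1: "length A + length [z] + length B1 \<le> k"
    proof (rule dec_boundedD[OF g C(1) _ C1(3)])
      show "sorted_wrt (>) (A @ [z] @ B1)"
        by (rule sorted_pivot[OF srt(1,4)]) (use ord(1,4) lt less_trans in blast)+
    qed (use inS subS xz in auto)
    have 2: "length A2 + length [x] + length B \<le> k"
    proof (rule dec_boundedD[OF g C2(1) _ C(3)])
      show "sorted_wrt (>) (A2 @ [x] @ B)"
        by (rule sorted_pivot[OF srt(5,2)]) (use ord(5,2) lt less_trans in blast)+
    qed (use inS subS xz in auto)
    have 3: "length A1 + length ([] :: nat list) + length B2 \<le> k"
    proof (rule dec_boundedD[OF g C1(1) _ C2(3)])
      show "sorted_wrt (>) (A1 @ [] @ B2)"
        by (rule sorted_pivot[OF srt(3,6)]) (use ord(3,6) in blast)+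
    qed (use inS in auto)
    have 4: "length A1 + length [x] + length B2 \<le> k" if M2: "M2 = [y, x]"
    proof (rule dec_boundedD[OF g C1(1) _ C2(3)])
      have "b \<in> set B2 \<Longrightarrow> b < x" for b using M2 C2(4) by (auto simp: sorted_wrt_append)
      then show "sorted_wrt (>) (A1 @ [x] @ B2)"
        using sorted_pivot[OF srt(3,6)] ord(3) lt less_trans by blast
    qed (use inS xz in auto)
    show False using M1 M2 1 2 3 4 C(6) C1(6) C2(6) M by auto
  qed
  then show ?thesis using card sub by blast
qed (use S in blast)


lemma dec_bounded_knuth:
  assumes "knuth w w'" "distinct w" "S \<subseteq> set w" "dec_bounded k S w"
  shows "\<exists>S' \<subseteq> set w. card S' = card S \<and> dec_bounded k S' w'"
  using assms
proof (induction rule: equivclp_induct)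
  case base
  then show ?case by blast
next
  case (step w1 w2)
  obtain S1 where S1: "S1 \<subseteq> set w" "card S1 = card S" "dec_bounded k S1 w1" using step by blast
  have w1: "set w1 = set w" "distinct w1"
    using knuth_mset[OF step(1)] step.prems(1) mset_eq_setD mset_eq_imp_distinct_iff by metis+
  from step(2) show ?case
  proof
    assume "knuth_step w1 w2"
    then show ?thesis
    proof cases
      case (xzy x y z u v)
      then show ?thesis using dec_bounded_knuth_step_xzy[OF xzy(3,4)] S1 w1 by metis
    next
      case (yxz x y z u v)
      then show ?thesis using dec_bounded_knuth_step_yxz[OF yxz(3,4)] S1 w1 by metis
    qed
  next
    assume "knuth_step w2 w1"
    then show ?thesis using dec_bounded_knuth_step_back S1 by blast
  qed
qed

text \<open>
  The label \<open>a\<close> may precede the label \<open>b\<close> in a reading word whose letters are given by \<open>f\<close>: equal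
  letters are numbered from left to right if their degree is 0, from right to left if it is 1.
\<close>

definition consistent :: "(nat \<Rightarrow> 'a) \<Rightarrow> ('a \<Rightarrow> nat) \<Rightarrow> nat \<Rightarrow> nat \<Rightarrow> bool" where
  "consistent f deg a b \<longleftrightarrow> (f a = f b \<longrightarrow> deg (f a) = (if a < b then 0 else 1))"

text \<open>Only \<open>x\<close> and \<open>z\<close> change their order. If they carried the same
  letter, so would \<open>y\<close> by monotonicity; of the two pairs containing \<open>y\<close>,
  whose order is kept, one ascends and one descends, so they would demand both degrees.\<close>

lemma knuth_step_consistent:
  fixes f :: "nat \<Rightarrow> 'a::linorder"
  assumes "knuth_step w w'" "mono_on (set w) f"
  shows "sorted_wrt (consistent f deg) w \<longleftrightarrow> sorted_wrt (consistent f deg) w'"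
  using assms
proof cases
  case (xzy x y z u v)
  have m: "f x \<le> f y" "f y \<le> f z" using assms(2) xzy by (auto simp: mono_on_def)
  have "consistent f deg x z \<and> consistent f deg z y \<and> consistent f deg x y
    \<longleftrightarrow> consistent f deg z x \<and> consistent f deg z y \<and> consistent f deg x y"
    using m xzy by (auto simp: consistent_def)
  then show ?thesis using xzy by (auto simp: sorted_wrt_append)
next
  case (yxz x y z u v)
  have m: "f x \<le> f y" "f y \<le> f z" using assms(2) yxz by (auto simp: mono_on_def)
  have "consistent f deg x z \<and> consistent f deg y z \<and> consistent f deg y x
    \<longleftrightarrow> consistent f deg z x \<and> consistent f deg y z \<and> consistent f deg y x"
    using m yxz by (auto simp: consistent_def)
  then show ?thesis using yxz by (auto simp: sorted_wrt_append)
qed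

text \<open>The tie conditions of the super plactic relations are exactly the consistency of the two
  pairs containing \<open>y\<close>.\<close>

lemma knuth_step_map:
  fixes f :: "nat \<Rightarrow> 'a::linorder"
  assumes "knuth_step w w'" "mono_on (set w) f" "f ` set w \<subseteq> A" "sorted_wrt (consistent f deg) w"
  shows "(map f w, map f w') \<in> plactic_cong A deg"
proof -
  have ctx: "(p @ q @ r, p @ q' @ r) \<in> plactic_cong A deg"
    if "plactic_gen A deg q q'" "set p \<subseteq> A" "set r \<subseteq> A" for p q q' r
    using that by (intro plactic_cong.mult plactic_cong.refl plactic_cong.gen) auto
  from assms(1) show ?thesis
  proof cases
    case (xzy x y z u v)
    have m: "f x \<le> f y" "f y \<le> f z" using assms(2) xzy by (auto simp: mono_on_def)
    have "plactic_gen A deg [f x, f z, f y] [f z, f x, f y]"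
      using assms(3,4) xzy m
      by (intro plactic_gen.xzy) (auto simp: consistent_def sorted_wrt_append)
    from ctx[OF this, of "map f u" "map f v"] show ?thesis using assms(3) xzy by auto
  next
    case (yxz x y z u v)
    have m: "f x \<le> f y" "f y \<le> f z" using assms(2) yxz by (auto simp: mono_on_def)
    have "plactic_gen A deg [f y, f x, f z] [f y, f z, f x]"
      using assms(3,4) yxz m
      by (intro plactic_gen.yxz) (auto simp: consistent_def sorted_wrt_append)
    from ctx[OF this, of "map f u" "map f v"] show ?thesis using assms(3) yxz by auto
  qed
qed

lemma knuth_consistent_map:
  fixes f :: "nat \<Rightarrow> 'a::linorder"
  assumes "knuth w w'" "mono_on (set w) f" "sorted_wrt (consistent f deg) w"
  shows "sorted_wrt (consistent f deg) w'"
    and "f ` set w \<subseteq> A \<Longrightarrow> (map f w, map f w') \<in> plactic_cong A deg"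
proof -
  have "sorted_wrt (consistent f deg) w' \<and>
    (f ` set w \<subseteq> A \<longrightarrow> (map f w, map f w') \<in> plactic_cong A deg)"
    using assms
  proof (induction rule: equivclp_induct)
    case base
    then show ?case by (auto intro!: plactic_cong.refl)
  next
    case (step w1 w2)
    have s: "set w1 = set w" "set w2 = set w"
      using knuth_mset[OF step(1)] knuth_mset[of w w2] step(1,2)
      by (metis mset_eq_setD, metis mset_eq_setD equivclp_into_equivclp)
    have c1: "sorted_wrt (consistent f deg) w1" using step by blast
    have c2: "sorted_wrt (consistent f deg) w2"
      using step(2) c1 knuth_step_consistent[of w1 w2 f deg] knuth_step_consistent[of w2 w1 f deg]
        step.prems(1) s by auto
    moreover have "(map f w1, map f w2) \<in> plactic_cong A deg" if "f ` set w \<subseteq> A"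
      using step(2) knuth_step_map[of w1 w2 f A deg] knuth_step_map[of w2 w1 f A deg]
        step.prems(1) s c1 c2 that by (auto intro: plactic_cong.sym)
    ultimately show ?case using step by (blast intro: plactic_cong.trans)
  qed
  then show "sorted_wrt (consistent f deg) w'"
    "f ` set w \<subseteq> A \<Longrightarrow> (map f w, map f w') \<in> plactic_cong A deg" by auto
qed

section \<open>Fillings and reading words\<close>

definition numbering :: "(nat \<times> nat) list \<Rightarrow> nat filling" where
  "numbering bs = map_of (zip bs [0..<length bs])"

lemma dom_numbering [simp]: "dom (numbering bs) = set bs"
  by (simp add: numbering_def)

lemma numbering_nth: "distinct bs \<Longrightarrow> m < length bs \<Longrightarrow> numbering bs (bs ! m) = Some m"
  by (simp add: numbering_def map_of_zip_nth)

lemma numbering_eq_Some: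
  assumes "distinct bs"
  shows "numbering bs b = Some m \<longleftrightarrow> m < length bs \<and> bs ! m = b"
proof
  assume s: "numbering bs b = Some m"
  then have "b \<in> set bs" by (metis domI dom_numbering)
  then obtain p where "p < length bs" "bs ! p = b" by (auto simp: in_set_conv_nth)
  then show "m < length bs \<and> bs ! m = b" using s numbering_nth[OF assms, of p] by auto
qed (use numbering_nth[OF assms] in auto)

lemma numbering_eq_None: "numbering bs b = None \<longleftrightarrow> b \<notin> set bs"
  by (metis domIff dom_numbering)

lemma numbering_move:
  assumes "distinct (ps @ h # b # bs)"
  shows "(numbering (ps @ b # bs))(h := Some (length ps), b := None) = numbering (ps @ h # bs)"
proof (rule ext)
  fix c
  have d: "distinct (ps @ b # bs)" "distinct (ps @ h # bs)" using assms by auto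
  consider "c = h" | "c = b" | "c \<notin> set (ps @ h # b # bs)" | "c \<in> set ps" | "c \<in> set bs" by auto
  then show "((numbering (ps @ b # bs))(h := Some (length ps), b := None)) c = numbering (ps @ h # bs) c"
  proof cases
    case 1
    then show ?thesis using assms numbering_nth[OF d(2), of "length ps"] by auto
  next
    case 2
    then show ?thesis using assms numbering_eq_None[of "ps @ h # bs" b] by auto
  next
    case 3
    then show ?thesis using numbering_eq_None[of "ps @ h # bs" c] numbering_eq_None[of "ps @ b # bs" c] by auto
  next
    case 4
    then obtain p where "p < length ps" "ps ! p = c" by (auto simp: in_set_conv_nth)
    then show ?thesis using assms 4 numbering_nth[OF d(1), of p] numbering_nth[OF d(2), of p]
      by (auto simp: nth_append)
  next
    case 5
    then obtain p where "p < length bs" "bs ! p = c" by (auto simp: in_set_conv_nth)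
    then show ?thesis using assms 5 numbering_nth[OF d(1), of "length ps + Suc p"]
        numbering_nth[OF d(2), of "length ps + Suc p"]
      by (auto simp: nth_append)
  qed
qed

section \<open>Reading words over a grid\<close>

definition row_word :: "nat \<Rightarrow> 'a filling \<Rightarrow> nat \<Rightarrow> 'a list" where
  "row_word N U i = map (\<lambda>j. the (U (i, j))) (filter (\<lambda>j. U (i, j) \<noteq> None) [0..<N])"

text \<open>Reading a fixed grid and skipping empty boxes makes sense for every intermediate filling
  of a rectification, without reference to its shape.\<close>

definition word :: "nat \<Rightarrow> 'a filling \<Rightarrow> 'a list" where
  "word N U = concat (map (row_word N U) (rev [0..<N]))"

definition before :: "nat \<times> nat \<Rightarrow> nat \<times> nat \<Rightarrow> bool" where
  "before b c \<longleftrightarrow> fst c < fst b \<or> fst b = fst c \<and> snd b < snd c"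

definition grid :: "nat \<Rightarrow> (nat \<times> nat) list" where
  "grid N = concat (map (\<lambda>i. map (Pair i) [0..<N]) (rev [0..<N]))"

lemma word_grid: "word N U = map (the \<circ> U) (filter (\<lambda>b. b \<in> dom U) (grid N))"
  by (simp add: word_def grid_def row_word_def[abs_def] filter_concat map_concat comp_def filter_map domIff)

lemma set_grid: "set (grid N) = {..<N} \<times> {..<N}"
  by (auto simp: grid_def)

lemma sorted_before_grid: "sorted_wrt before (grid N)"
proof -
  have "sorted_wrt before (concat (map (\<lambda>i. map (Pair i) [0..<N]) (rev [0..<M])))" for M
  proof (induction M)
    case (Suc M)
    have "sorted_wrt before (map (Pair M) [0..<N])"
      by (simp add: sorted_wrt_map before_def)
    then show ?case using Suc by (simp add: sorted_wrt_append) (auto simp: before_def)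
  qed simp
  then show ?thesis by (simp add: grid_def)
qed

lemma distinct_grid: "distinct (grid N)"
  using sorted_before_grid[of N] unfolding distinct_conv_nth sorted_wrt_iff_nth_less before_def
  by (metis linorder_neqE_nat less_irrefl)

lemma sorted_wrt_word:
  assumes "dom U \<subseteq> {..<N} \<times> {..<N}"
  shows "sorted_wrt R (word N U) \<longleftrightarrow>
    (\<forall>b c. b \<in> dom U \<and> c \<in> dom U \<and> before b c \<longrightarrow> R (the (U b)) (the (U c)))"
proof -
  let ?l = "filter (\<lambda>b. b \<in> dom U) (grid N)"
  have s: "sorted_wrt before ?l" by (intro sorted_wrt_filter sorted_before_grid)
  have l: "set ?l = dom U" using assms by (auto simp: set_grid)
  have tr: "\<not> (before b c \<and> before c b)" "\<not> before b b" for b c by (auto simp: before_def)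
  have "sorted_wrt (\<lambda>b c. R (the (U b)) (the (U c))) ?l \<longleftrightarrow>
    (\<forall>b c. b \<in> set ?l \<and> c \<in> set ?l \<and> before b c \<longrightarrow> R (the (U b)) (the (U c)))" (is "?A \<longleftrightarrow> ?B")
  proof
    assume A: ?A
    show ?B
    proof (intro allI impI, elim conjE)
      fix b c assume bc: "b \<in> set ?l" "c \<in> set ?l" "before b c"
      obtain p q where pq: "p < length ?l" "q < length ?l" "?l ! p = b" "?l ! q = c"
        using bc(1,2) unfolding in_set_conv_nth by blast
      have "p < q"
      proof (rule ccontr)
        assume "\<not> p < q"
        then have "q < p \<or> p = q" by auto
        then show False using s pq bc(3) tr unfolding sorted_wrt_iff_nth_less by metis
      qed
      then show "R (the (U b)) (the (U c))" using A pq unfolding sorted_wrt_iff_nth_less by blast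
    qed
  next
    assume ?B
    then show ?A using s by (intro sorted_wrt_mono_rel[OF _ s]) blast
  qed
  then show ?thesis unfolding l word_grid sorted_wrt_map comp_def .
qed

lemma set_word: "dom U \<subseteq> {..<N} \<times> {..<N} \<Longrightarrow> set (word N U) = ran U"
  by (force simp: word_grid set_grid ran_def dom_def image_iff)

lemma set_word_numbering:
  assumes "distinct bs" "set bs \<subseteq> {..<N} \<times> {..<N}"
  shows "set (word N (numbering bs)) = {..<length bs}"
proof -
  have "ran (numbering bs) = {..<length bs}"
    using assms(1) by (auto simp: ran_def numbering_eq_Some)
  then show ?thesis using set_word[of "numbering bs" N] assms by simp
qed

lemma word_map_option: "word N (map_option f \<circ> U) = map f (word N U)"
  by (auto simp: word_grid dom_def comp_def intro!: filter_cong map_cong)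

lemma distinct_word_numbering:
  assumes "distinct bs"
  shows "distinct (word N (numbering bs))"
proof -
  have "inj_on (the \<circ> numbering bs) (set bs)"
  proof (rule inj_onI)
    fix b c assume "b \<in> set bs" "c \<in> set bs" "(the \<circ> numbering bs) b = (the \<circ> numbering bs) c"
    then show "b = c" using numbering_nth[OF assms] by (auto simp: in_set_conv_nth)
  qed
  then show ?thesis using distinct_grid
    by (auto simp: word_grid distinct_map intro: inj_on_subset)
qed


text \<open>With injective \<open>f\<close> there are no ties. This allows the simulation lemmas,
  stated for letters, to be applied to bare labels.\<close>

lemma consistent_inj:
  assumes "distinct bs" "inj_on f UNIV"
  shows "sorted_wrt (consistent f deg) (word N (numbering bs))"
  using distinct_word_numbering[OF assms(1), of N] injD[OF assms(2)]
  unfolding distinct_conv_nth sorted_wrt_iff_nth_less consistent_def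
  by (metis less_trans nat_neq_iff)

lemma upt_split: "a \<le> j \<Longrightarrow> j \<le> e \<Longrightarrow> [a..<e] = [a..<j] @ [j..<e]" for a j e :: nat
  by (metis le_add_diff_inverse upt_add_eq_append)

lemma filter_upt_interval: "e \<le> N \<Longrightarrow> filter (\<lambda>k. a \<le> k \<and> k < e) [0..<N] = [a..<e]"
  by (rule map_sorted_distinct_set_unique[of id]) (auto intro: sorted_wrt_filter)

lemma filter_upt_interval_neq:
  "a \<le> j \<Longrightarrow> j < e \<Longrightarrow> e \<le> N \<Longrightarrow>
    filter (\<lambda>k. a \<le> k \<and> k < e \<and> k \<noteq> j) [0..<N] = [a..<j] @ [Suc j..<e]"
  by (rule map_sorted_distinct_set_unique[of id]) (auto intro: sorted_wrt_filter simp: sorted_append)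

lemma row_word_cong: "(\<And>k. U (i, k) = V (i, k)) \<Longrightarrow> row_word N U i = row_word N V i"
  by (simp add: row_word_def)

text \<open>The entry stays in its row and crosses only an empty box, which the reading
  skips.\<close>

lemma word_slide_left:
  assumes "U (i, j) = None" "U (i, Suc j) = Some y" "Suc j < N"
  shows "word N (U((i, j) := Some y, (i, Suc j) := None)) = word N U" (is "word N ?V = _")
proof -
  have split: "[0..<N] = [0..<j] @ [j, Suc j] @ [Suc (Suc j)..<N]"
    using assms(3) upt_split[of 0 j N] by (simp add: upt_conv_Cons)
  have "row_word N ?V r = row_word N U r" for r
  proof (cases "r = i")
    case True
    have "map (\<lambda>k. the (?V (i, k))) (filter (\<lambda>k. ?V (i, k) \<noteq> None) xs) =
      map (\<lambda>k. the (U (i, k))) (filter (\<lambda>k. U (i, k) \<noteq> None) xs)" if "j \<notin> set xs" "Suc j \<notin> set xs" for xs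
      using that by (intro map_cong filter_cong) auto
    from this[of "[0..<j]"] this[of "[Suc (Suc j)..<N]"] show ?thesis
      unfolding row_word_def split True filter_append map_append using assms by simp
  next
    case False
    then show ?thesis by (intro row_word_cong) auto
  qed
  then have "row_word N ?V = row_word N U" by (rule ext)
  then show ?thesis by (simp add: word_def)
qed

text \<open>Only the columns from \<open>a\<close> to \<open>e' - 1\<close> meet both rows, and
  there \<open>knuth_vertical\<close> applies. The overhang of the lower row on the left and that of
  the upper row on the right stand at the two ends of the joint word and serve as context. The
  common value \<open>r j = r' j\<close> is the moving entry, so both rows can be treated as if they
  had no hole.\<close>

lemma word_slide_up:
  fixes r r' :: "nat \<Rightarrow> nat"
  assumes U1: "\<And>k. U (i, k) = (if a \<le> k \<and> k < e \<and> k \<noteq> j then Some (r k) else None)"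
    and U2: "\<And>k. U (Suc i, k) = (if a' \<le> k \<and> k < e' then Some (r' k) else None)"
    and le: "a' \<le> a" "a \<le> j" "j < e'" "e' \<le> e" "e \<le> N" "Suc i < N"
    and eq: "r j = r' j" and lt: "\<And>k. a \<le> k \<Longrightarrow> k < e' \<Longrightarrow> k \<noteq> j \<Longrightarrow> r k < r' k"
    and s: "sorted_wrt (<) (map r [a..<e])" "sorted_wrt (<) (map r' [a'..<e'])"
  shows "knuth (word N U) (word N (U((i, j) := Some (r j), (Suc i, j) := None)))" (is "knuth _ (word N ?V)")
proof -
  have V1: "?V (i, k) = (if a \<le> k \<and> k < e then Some (r k) else None)" for k
    using U1 le by auto
  have V2: "?V (Suc i, k) = (if a' \<le> k \<and> k < e' \<and> k \<noteq> j then Some (r' k) else None)" for k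
    using U2 le by auto
  have none: "((if P then Some x else None) \<noteq> None) = P" for P and x :: nat by simp
  have row: "map (\<lambda>k. the (if P k then Some (f k) else None)) (filter P xs) = map f (filter P xs)"
    for P and f :: "nat \<Rightarrow> nat" and xs by (intro map_cong) auto
  have sp: "[a..<e] = [a..<j] @ j # [Suc j..<e'] @ [e'..<e]"
    using le upt_split[of a j e] upt_split[of "Suc j" e' e] by (simp add: upt_conv_Cons)
  have sp': "[a'..<e'] = [a'..<a] @ [a..<j] @ j # [Suc j..<e']"
    using le upt_split[of a' a e'] upt_split[of a j e'] by (simp add: upt_conv_Cons)
  have spj: "[a..<j] @ [Suc j..<e] = [a..<j] @ [Suc j..<e'] @ [e'..<e]"
    "[a'..<j] @ [Suc j..<e'] = [a'..<a] @ [a..<j] @ [Suc j..<e']"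
    using le upt_split[of "Suc j" e' e] upt_split[of a' a j] by simp_all
  have UI: "row_word N U i = map r [a..<j] @ map r [Suc j..<e'] @ map r [e'..<e]"
    unfolding row_word_def U1 none row using le by (simp add: filter_upt_interval_neq spj)
  have UI': "row_word N U (Suc i) = map r' [a'..<a] @ map r' [a..<j] @ r' j # map r' [Suc j..<e']"
    unfolding row_word_def U2 none row using le by (simp add: filter_upt_interval sp')
  have VI: "row_word N ?V i = map r [a..<j] @ r' j # map r [Suc j..<e'] @ map r [e'..<e]"
    unfolding row_word_def V1 none row using le eq by (simp add: filter_upt_interval sp)
  have VI': "row_word N ?V (Suc i) = map r' [a'..<a] @ map r' [a..<j] @ map r' [Suc j..<e']"
    unfolding row_word_def V2 none row using le by (simp add: filter_upt_interval_neq spj)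
  have rev: "rev [0..<N] = rev [Suc (Suc i)..<N] @ [Suc i, i] @ rev [0..<i]"
    using le upt_split[of 0 i N] by (simp add: upt_conv_Cons)
  have oth: "row_word N ?V q = row_word N U q" if "q \<noteq> i" "q \<noteq> Suc i" for q
    using that by (intro row_word_cong) auto
  have oths: "map (row_word N ?V) (rev [Suc (Suc i)..<N]) = map (row_word N U) (rev [Suc (Suc i)..<N])"
    "map (row_word N ?V) (rev [0..<i]) = map (row_word N U) (rev [0..<i])"
    by (intro map_cong oth; auto)+
  define p where "p = concat (map (row_word N U) (rev [Suc (Suc i)..<N]))"
  define q where "q = concat (map (row_word N U) (rev [0..<i]))"
  have "knuth (map r' [a..<j] @ r' j # map r' [Suc j..<e'] @ map r [a..<j] @ map r [Suc j..<e'])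
    (map r' [a..<j] @ map r' [Suc j..<e'] @ map r [a..<j] @ r' j # map r [Suc j..<e'])"
  proof (rule knuth_vertical)
    show "list_all2 (<) (map r [a..<j]) (map r' [a..<j])"
      using lt le by (auto simp: list_all2_conv_all_nth)
    show "list_all2 (<) (map r [Suc j..<e']) (map r' [Suc j..<e'])"
      using lt le by (auto simp: list_all2_conv_all_nth)
    show "sorted_wrt (<) (map r' [a..<j] @ r' j # map r' [Suc j..<e'])"
      using s(2) unfolding sp' by (simp add: sorted_wrt_append)
    show "sorted_wrt (<) (map r [a..<j] @ r' j # map r [Suc j..<e'])"
      using s(1) unfolding sp eq[symmetric] by (simp add: sorted_wrt_append)
  qed
  from knuth_context[OF this, of "p @ map r' [a'..<a]" "map r [e'..<e] @ q"]
  show ?thesis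
    unfolding word_def rev map_append concat_append oths p_def q_def
    by (simp add: UI UI' VI VI' del: fun_upd_apply)
qed

section \<open>Slides on standard fillings\<close>

text \<open>Hole and moving entry occupy consecutive places of one chain: dropping the first of the
  two boxes gives the filling before the move, dropping the second the filling after it. The chain
  containing both provides the inequalities within and between the two rows.\<close>

lemma knuth_slide_up:
  assumes g: "grows Y (ps @ (i, j) # (Suc i, j) # bs) L" and N: "L \<subseteq> {..<N} \<times> {..<N}"
  shows "knuth (word N (numbering (ps @ (Suc i, j) # bs))) (word N (numbering (ps @ (i, j) # bs)))"
proof -
  define zs where "zs = ps @ (i, j) # (Suc i, j) # bs"
  note g = g[folded zs_def]
  have L: "L = Y \<union> set zs" "Y \<inter> set zs = {}" and d: "distinct zs" using grows_set[OF g] by auto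
  obtain p where p: "is_partition p" "Y = diagram p" using idealE grows_idealD[OF g] by metis
  obtain q where q: "is_partition q" "L = diagram q" using idealE grows_idealD[OF g] by metis
  have zs: "(r, k) \<in> set zs \<longleftrightarrow> p r \<le> k \<and> k < q r" for r k
  proof -
    have "(r, k) \<in> set zs \<longleftrightarrow> (r, k) \<in> L \<and> (r, k) \<notin> Y" using L by blast
    then show ?thesis by (auto simp: p(2) q(2) diagram_def)
  qed
  define pos where "pos z = the (numbering zs z)" for z
  have pos: "pos z < length zs" "zs ! pos z = z" if "z \<in> set zs" for z
    using that numbering_nth[OF d] by (auto simp: pos_def in_set_conv_nth)
  have pos_less: "pos (r, k) < pos (r', k')"
    if "(r, k) \<in> set zs" "(r', k') \<in> set zs" "r \<le> r'" "k \<le> k'" "(r, k) \<noteq> (r', k')" for r k r' k'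
  proof (rule grows_less[OF g])
    show "pos (r, k) \<noteq> pos (r', k')" using that pos by metis
    show "pos (r', k') < length zs" "zs ! pos (r', k') = (r', k')"
      "pos (r, k) < length zs" "zs ! pos (r, k) = (r, k)" using that(1,2) pos by blast+
  qed (use that(3,4) in simp_all)
  \<comment> \<open>The hole and the box below it, whose entry moves, share a label, so that both rows are increasing.\<close>
  define lab where "lab z = (if pos z \<le> length ps then pos z else pos z - 1)" for z
  have dU: "distinct (ps @ (Suc i, j) # bs)" using d by (auto simp: zs_def)
  have pij: "pos (i, j) = length ps" "pos (Suc i, j) = Suc (length ps)"
    using numbering_nth[OF d, of "length ps"] numbering_nth[OF d, of "Suc (length ps)"]
    by (auto simp: pos_def zs_def nth_append)
  have lab: "numbering (ps @ (Suc i, j) # bs) z = Some (lab z)" if z: "z \<in> set zs" "z \<noteq> (i, j)" for z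
  proof -
    have ne: "pos z \<noteq> length ps" using pos(2)[OF z(1)] z(2) by (auto simp: zs_def)
    have "(ps @ (Suc i, j) # bs) ! lab z = z"
    proof (cases "pos z < length ps")
      case True
      then show ?thesis using pos(2)[OF z(1)] by (simp add: lab_def zs_def nth_append)
    next
      case False
      then obtain m where m: "pos z = length ps + Suc m" using ne less_imp_Suc_add[of "length ps" "pos z"] by auto
      then show ?thesis using pos(2)[OF z(1)] by (simp add: lab_def zs_def nth_append)
    qed
    moreover have "lab z < length (ps @ (Suc i, j) # bs)"
      using pos(1)[OF z(1)] ne by (auto simp: lab_def zs_def)
    ultimately show ?thesis using numbering_nth[OF dU] by metis
  qed
  have lab_less: "lab z < lab z'" if "pos z < pos z'" "z \<noteq> (i, j) \<or> z' \<noteq> (Suc i, j)"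
    "z \<in> set zs" "z' \<in> set zs" for z z'
  proof -
    consider "pos z' \<le> length ps" | "pos z < length ps" "length ps < pos z'"
      | "pos z = length ps" "length ps < pos z'" | "length ps < pos z" "length ps < pos z'"
      using that(1) by linarith
    then show ?thesis
    proof cases
      case 3
      have "z = (i, j)" using pos(2)[OF that(3)] 3(1) by (simp add: zs_def nth_append)
      then have "z' \<noteq> (Suc i, j)" using that(2) by simp
      then have "pos z' \<noteq> Suc (length ps)" using pos(2)[OF that(4)] by (auto simp: zs_def nth_append)
      then show ?thesis using 3 by (simp add: lab_def)
    qed (use that(1) in \<open>simp_all add: lab_def\<close>)
  qed
  have labe: "lab (i, j) = length ps" "lab (Suc i, j) = length ps" using pij by (auto simp: lab_def)
  have mem: "(i, j) \<in> set zs" "(Suc i, j) \<in> set zs" by (auto simp: zs_def)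
  have pm: "p (Suc i) \<le> p i" "q (Suc i) \<le> q i"
    using p(1) q(1) by (auto simp: is_partition_def monotone_def)
  have bounds: "p i \<le> j" "j < q (Suc i)" using mem zs by auto
  have qN: "q r \<le> N" for r
  proof (rule ccontr)
    assume "\<not> q r \<le> N"
    then have "(r, N) \<in> L" using q(2) by (simp add: diagram_def)
    then show False using N by auto
  qed
  have iN: "Suc i < N" using N mem(2) L by auto
  have "knuth (word N (numbering (ps @ (Suc i, j) # bs)))
    (word N ((numbering (ps @ (Suc i, j) # bs))((i, j) := Some (lab (i, j)), (Suc i, j) := None)))"
  proof (rule word_slide_up[where a = "p i" and e = "q i" and a' = "p (Suc i)" and e' = "q (Suc i)"
        and r = "\<lambda>k. lab (i, k)" and r' = "\<lambda>k. lab (Suc i, k)"])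
    show "numbering (ps @ (Suc i, j) # bs) (i, k) =
      (if p i \<le> k \<and> k < q i \<and> k \<noteq> j then Some (lab (i, k)) else None)" for k
      using lab[of "(i, k)"] zs[of i k] d numbering_eq_None[of "ps @ (Suc i, j) # bs" "(i, k)"]
      by (auto simp: zs_def)
    show "numbering (ps @ (Suc i, j) # bs) (Suc i, k) =
      (if p (Suc i) \<le> k \<and> k < q (Suc i) then Some (lab (Suc i, k)) else None)" for k
      using lab[of "(Suc i, k)"] zs[of "Suc i" k] d numbering_eq_None[of "ps @ (Suc i, j) # bs" "(Suc i, k)"]
      by (auto simp: zs_def)
    show "lab (i, k) < lab (Suc i, k)" if "p i \<le> k" "k < q (Suc i)" "k \<noteq> j" for k
      using that pm zs by (intro lab_less pos_less) auto
    have "sorted_wrt (<) (map (\<lambda>k. lab (r, k)) [p r..<q r])" for r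
      unfolding sorted_wrt_map using zs
      by (intro sorted_wrt_mono_rel[OF _ sorted_wrt_upt]) (auto intro!: lab_less pos_less)
    then show "sorted_wrt (<) (map (\<lambda>k. lab (i, k)) [p i..<q i])"
      "sorted_wrt (<) (map (\<lambda>k. lab (Suc i, k)) [p (Suc i)..<q (Suc i)])" by blast+
  qed (use pm bounds qN iN labe in auto)
  also have "(numbering (ps @ (Suc i, j) # bs))((i, j) := Some (lab (i, j)), (Suc i, j) := None)
    = numbering (ps @ (i, j) # bs)"
    unfolding labe by (rule numbering_move) (use d zs_def in auto)
  finally show ?thesis .
qed

lemma knuth_slide_left:
  assumes g: "grows Y (ps @ (i, j) # (i, Suc j) # bs) L" and N: "L \<subseteq> {..<N} \<times> {..<N}"
  shows "word N (numbering (ps @ (i, j) # bs)) = word N (numbering (ps @ (i, Suc j) # bs))"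
proof -
  have L: "L = Y \<union> set (ps @ (i, j) # (i, Suc j) # bs)" and d: "distinct (ps @ (i, j) # (i, Suc j) # bs)"
    using grows_set[OF g] by auto
  have "word N ((numbering (ps @ (i, Suc j) # bs))((i, j) := Some (length ps), (i, Suc j) := None)) =
    word N (numbering (ps @ (i, Suc j) # bs))"
  proof (rule word_slide_left)
    show "numbering (ps @ (i, Suc j) # bs) (i, j) = None"
      using d by (auto simp: numbering_eq_None)
    show "numbering (ps @ (i, Suc j) # bs) (i, Suc j) = Some (length ps)"
      using d by (subst numbering_eq_Some) auto
    show "Suc j < N" using N L by auto
  qed
  then show ?thesis using numbering_move[OF d] by simp
qed

text \<open>
  The boxes \<open>ps\<close> have smaller entries than those next to the hole \<open>h\<close> and keep their place.
\<close>

lemma slide_simulation: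
  fixes f :: "nat \<Rightarrow> 'a::linorder"
  assumes "grows Y (ps @ h # bs) L" "L \<subseteq> {..<N} \<times> {..<N}" "\<forall>z\<in>set ps. \<not> adj h z"
    "mono_on {..<length (ps @ bs)} f" "sorted_wrt (consistent f deg) (word N (numbering (ps @ bs)))"
    "slide_list h bs = (bs', h')"
  shows "knuth (word N (numbering (ps @ bs))) (word N (numbering (ps @ bs'))) \<and>
    slide deg h (map_option f \<circ> numbering (ps @ bs)) (map_option f \<circ> numbering (ps @ bs'))"
  using assms
proof (induction bs arbitrary: ps h bs' h')
  case Nil
  obtain i j where h: "h = (i, j)" by (cases h)
  have "numbering ps (i + 1, j) = None" "numbering ps (i, j + 1) = None"
    using Nil.prems(3) h by (auto simp: numbering_eq_None adj_def)
  then show ?case using Nil h by (auto intro!: slide.stop)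
next
  case (Cons b bs)
  note g = Cons.prems(1)
  have d: "distinct (ps @ h # b # bs)" "L = Y \<union> set (ps @ h # b # bs)" using grows_set[OF g] by auto
  have dU: "distinct (ps @ b # bs)" and sub: "set (ps @ b # bs) \<subseteq> {..<N} \<times> {..<N}"
    using d Cons.prems(2) by auto
  let ?U = "map_option f \<circ> numbering (ps @ b # bs)"
  show ?case
  proof (cases "adj h b")
    case True
    obtain bs1 h1 where sl: "slide_list b bs = (bs1, h1)" by (cases "slide_list b bs") blast
    have bs': "bs' = h # bs1" using Cons.prems(6) True sl by (auto simp: exchange_def)
    obtain i j where h: "h = (i, j)" by (cases h)
    have b: "b = (Suc i, j) \<or> b = (i, Suc j)" using True h by (auto simp: adj_def)
    have kn: "knuth (word N (numbering (ps @ b # bs))) (word N (numbering (ps @ h # bs)))"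
      using b knuth_slide_up[of Y ps i j bs L N] knuth_slide_left[of Y ps i j bs L N] g h Cons.prems(2) by auto
    have cons: "sorted_wrt (consistent f deg) (word N (numbering (ps @ h # bs)))"
      by (rule knuth_consistent_map(1)[OF kn _ Cons.prems(5)])
        (use set_word_numbering[OF dU sub] Cons.prems(4) in simp)
    \<comment> \<open>The invariant on \<open>ps\<close> survives for the new hole: \<open>h\<close>
      and the boxes of \<open>ps\<close> precede \<open>b\<close> in the chain, whereas boxes
      adjacent to \<open>b\<close> come after it.\<close>
    have na: "\<forall>z\<in>set (ps @ [h]). \<not> adj b z"
    proof
      fix z assume z: "z \<in> set (ps @ [h])"
      then obtain q where q: "q < Suc (length ps)" "(ps @ [h]) ! q = z"
        unfolding in_set_conv_nth by auto
      show "\<not> adj b z"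
      proof
        assume a: "adj b z"
        have "Suc (length ps) < q"
        proof (rule grows_less[OF g])
          show "(ps @ h # b # bs) ! q = (fst z, snd z)"
            using q by (cases "q = length ps") (auto simp: nth_append)
          show "(ps @ h # b # bs) ! Suc (length ps) = (fst b, snd b)" by (simp add: nth_append)
        qed (use q a in \<open>auto simp: adj_def\<close>)
        then show False using q by simp
      qed
    qed
    have IH: "knuth (word N (numbering (ps @ h # bs))) (word N (numbering (ps @ h # bs1)))"
      "slide deg b (map_option f \<circ> numbering (ps @ h # bs)) (map_option f \<circ> numbering (ps @ h # bs1))"
      using Cons.IH[of "ps @ [h]" b bs1 h1] g Cons.prems(2,4) na cons sl by (auto simp: comp_def)
    have mv: "?U(h := Some (f (length ps)), b := None) = map_option f \<circ> numbering (ps @ h # bs)"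
      unfolding numbering_move[OF d(1), symmetric] by (auto simp: fun_eq_iff)
    have Ub: "?U b = Some (f (length ps))" using numbering_nth[OF dU, of "length ps"] by simp
    \<comment> \<open>The competing neighbour \<open>c\<close> of the hole has a larger label. If
      the letters tie, consistency yields degree 0 when \<open>b\<close> is the box below, which is
      read first, and degree 1 when \<open>b\<close> is the box to the right: the tie-breaking of
      \<open>slide\<close> agrees with the labels.\<close>
    have nb: "\<exists>m. length ps < m \<and> x = f m \<and> f (length ps) \<le> x \<and> consistent f deg (if before b c then length ps else m)
          (if before b c then m else length ps)"
      if c: "?U c = Some x" "adj h c" "c \<noteq> b" "before b c \<or> before c b" for c x
    proof -
      obtain m where m: "m < length (ps @ b # bs)" "(ps @ b # bs) ! m = c" "x = f m"
        using c(1) numbering_eq_Some[OF dU] by auto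
      have "\<not> m < length ps" using m c(2) Cons.prems(3) by (auto simp: nth_append)
      moreover have "m \<noteq> length ps" using m c(3) by auto
      ultimately have lt: "length ps < m" by simp
      moreover have "f (length ps) \<le> f m" using Cons.prems(4) m(1) lt by (auto simp: mono_on_def)
      moreover have "consistent f deg (if before b c then length ps else m) (if before b c then m else length ps)"
      proof -
        have n: "numbering (ps @ b # bs) b = Some (length ps)" "numbering (ps @ b # bs) c = Some m"
          using numbering_nth[OF dU, of "length ps"] numbering_nth[OF dU, of m] m by auto
        then have dm: "b \<in> dom (numbering (ps @ b # bs))" "c \<in> dom (numbering (ps @ b # bs))" by blast+
        have dN: "dom (numbering (ps @ b # bs)) \<subseteq> {..<N} \<times> {..<N}" unfolding dom_numbering by (rule sub)
        note sw = sorted_wrt_word[OF dN, THEN iffD1, OF Cons.prems(5), rule_format]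
        show ?thesis
        proof (cases "before b c")
          case True
          then show ?thesis using sw[of b c] dm n by simp
        next
          case False
          then show ?thesis using sw[of c b] dm n c(4) by simp
        qed
      qed
      ultimately show ?thesis using m(3) by blast
    qed
    have "slide deg h ?U (map_option f \<circ> numbering (ps @ h # bs1))"
      using b
    proof
      assume b: "b = (Suc i, j)"
      have "slide deg (i, j) ?U (map_option f \<circ> numbering (ps @ h # bs1))"
      proof (rule slide.up)
        show "?U (i + 1, j) = Some (f (length ps))" using Ub b by simp
        show "\<forall>y. ?U (i, j + 1) = Some y \<longrightarrow> f (length ps) < y \<or> f (length ps) = y \<and> deg (f (length ps)) = 0"
        proof (intro allI impI)
          fix y assume "?U (i, j + 1) = Some y"
          from nb[OF this] show "f (length ps) < y \<or> f (length ps) = y \<and> deg (f (length ps)) = 0"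
            using b h by (force simp: adj_def before_def consistent_def)
        qed
        show "slide deg (i + 1, j) (?U((i, j) := Some (f (length ps)), (i + 1, j) := None))
          (map_option f \<circ> numbering (ps @ h # bs1))"
          using IH(2) mv b h by simp
      qed
      then show ?thesis by (simp add: h)
    next
      assume b: "b = (i, Suc j)"
      have "slide deg (i, j) ?U (map_option f \<circ> numbering (ps @ h # bs1))"
      proof (rule slide.left)
        show "?U (i, j + 1) = Some (f (length ps))" using Ub b by simp
        show "\<forall>x. ?U (i + 1, j) = Some x \<longrightarrow> f (length ps) < x \<or> x = f (length ps) \<and> deg x = 1"
        proof (intro allI impI)
          fix x assume "?U (i + 1, j) = Some x"
          from nb[OF this] show "f (length ps) < x \<or> x = f (length ps) \<and> deg x = 1"
            using b h by (force simp: adj_def before_def consistent_def)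
        qed
        show "slide deg (i, j + 1) (?U((i, j) := Some (f (length ps)), (i, j + 1) := None))
          (map_option f \<circ> numbering (ps @ h # bs1))"
          using IH(2) mv b h by simp
      qed
      then show ?thesis by (simp add: h)
    qed
    then show ?thesis using equivclp_trans[OF kn IH(1)] by (simp add: bs' comp_def)
  next
    case False
    obtain bs1 h1 where sl: "slide_list h bs = (bs1, h1)" by (cases "slide_list h bs") blast
    have bs': "bs' = b # bs1" using Cons.prems(6) False sl by (auto simp: exchange_def)
    \<comment> \<open>Here the hole does not move: \<open>b\<close> is placed before it in the chain
      and joins the settled boxes.\<close>
    have "grows Y (ps @ b # h # bs) L"
      using g exchange_grows(1)[of _ h b bs L b h] False unfolding grows_append by (auto simp: exchange_def)
    then show ?thesis
      using Cons.IH[of "ps @ [b]" h bs1 h1] Cons.prems(2-5) False sl bs' by (auto simp: comp_def)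
  qed
qed

text \<open>The conditions of \<open>up\<close> and \<open>left\<close> exclude each other, since a
  tie is decided by the degree.\<close>

lemma slide_deterministic: "slide deg h U V \<Longrightarrow> slide deg h U W \<Longrightarrow> W = V"
proof (induction arbitrary: W rule: slide.induct)
  case (stop U i j)
  from stop(3,1,2) show ?case by cases auto
next
  case (up U i j x V)
  from up.prems up.hyps(1,2) up.IH show ?case by cases (auto simp del: fun_upd_apply)
next
  case (left U i j y V)
  from left.prems left.hyps(1,2) left.IH show ?case by cases (auto simp del: fun_upd_apply)
qed

section \<open>Uniqueness of the tableau in a Knuth class\<close>

lemma card_rows_diagram: "card {b \<in> diagram p. fst b < k} = sum p {..<k}"
proof -
  have "{b \<in> diagram p. fst b < k} = Sigma {..<k} (\<lambda>i. {..<p i})" by (auto simp: diagram_def)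
  then show ?thesis by simp
qed

lemma ideal_eqI:
  assumes "order_ideal D" "order_ideal E" "\<And>k. card {b \<in> D. fst b < k} = card {b \<in> E. fst b < k}"
  shows "D = E"
proof -
  obtain p q where pq: "D = diagram p" "E = diagram q" using assms(1,2) idealE by metis
  have "sum p {..<k} = sum q {..<k}" for k using assms(3)[of k] by (simp add: pq card_rows_diagram)
  then have "p k = q k" for k
    by (metis add_left_imp_eq sum.lessThan_Suc)
  then have "p = q" by blast
  then show ?thesis by (simp add: pq)
qed

lemma subseq_sorted_wrt: "subseq xs ys \<Longrightarrow> sorted_wrt R ys \<Longrightarrow> sorted_wrt R xs"
proof (induction rule: list_emb.induct)
  case (list_emb_Cons2 x y xs ys)
  then show ?case using subseq_set[of xs ys] by auto
qed auto

section \<open>Greene's theorem for standard tableaux\<close>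

lemma card_columns:
  assumes "finite X" "X \<subseteq> UNIV \<times> {..<N :: nat}"
  shows "card X = (\<Sum>j<N. card {b \<in> X. snd b = j})"
  using sum.group[of X "{..<N}" snd "\<lambda>_. 1 :: nat"] assms by fastforce

lemma nth_numbering: "distinct T \<Longrightarrow> b \<in> set T \<Longrightarrow> T ! the (numbering T b) = b"
  using numbering_nth by (fastforce simp: in_set_conv_nth)

text \<open>The letters of \<open>S\<close> in one column are read upwards as a decreasing chain, so
  there are at most \<open>k\<close> of them. A column with more than \<open>k\<close> boxes has
  \<open>k\<close> boxes in the first \<open>k\<close> rows, and a shorter one lies entirely
  there.\<close>

lemma dec_bounded_tableau_le:
  assumes g: "grows {} T D" and N: "D \<subseteq> {..<N} \<times> {..<N}"
    and S: "S \<subseteq> {..<length T}" and dec_bounded: "dec_bounded k S (word N (numbering T))"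
  shows "card S \<le> card {b \<in> D. fst b < k}"
proof -
  have D: "D = set T" and d: "distinct T" and i: "order_ideal D"
    using grows_set[OF g] grows_idealD[OF g] by auto
  let ?X = "(!) T ` S"
  have X: "?X \<subseteq> D" using S D by auto
  have inj: "inj_on ((!) T) S" using S d by (intro inj_on_nth) auto
  have fin: "finite D" using i idealD by blast
  have col: "card {b \<in> ?X. snd b = j} \<le> card {b \<in> {b \<in> D. fst b < k}. snd b = j}" for j
  proof (cases "(k, j) \<in> D")
    case True
    let ?C = "filter (\<lambda>b. b \<in> ?X \<and> snd b = j) (grid N)"
    let ?n = "the \<circ> numbering T"
    have setC: "set ?C = {b \<in> ?X. snd b = j}" using X N by (auto simp: set_grid)
    have eq: "?C = filter (\<lambda>b. b \<in> ?X \<and> snd b = j) (filter (\<lambda>b. b \<in> dom (numbering T)) (grid N))"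
      using X D by (auto intro!: filter_cong)
    have "subseq (map ?n ?C) (word N (numbering T))"
      unfolding word_grid eq by (rule subseq_map[OF subseq_filter_left])
    moreover have "sorted_wrt (>) (map ?n ?C)"
    proof -
      have "sorted_wrt before ?C" by (intro sorted_wrt_filter sorted_before_grid)
      then show ?thesis
        unfolding sorted_wrt_map
      proof (rule sorted_wrt_mono_rel[rotated])
        fix b c assume bc: "b \<in> set ?C" "c \<in> set ?C" "before b c"
        obtain p q where pq: "p < length T" "T ! p = b" "q < length T" "T ! q = c"
          using bc S by auto
        have "q < p"
          by (rule grows_less_nth[OF g pq(3,1)])
            (use pq bc in \<open>auto simp: before_def\<close>)
        then show "?n b > ?n c" using pq numbering_nth[OF d] by auto
      qed
    qed
    moreover have "set (map ?n ?C) \<subseteq> S" using numbering_nth[OF d] S by auto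
    ultimately have "length (map ?n ?C) \<le> k" using dec_bounded unfolding dec_bounded_def by blast
    then have "length ?C \<le> k" by simp
    moreover have "length ?C = card {b \<in> ?X. snd b = j}"
      unfolding setC[symmetric] by (rule distinct_card[symmetric]) (simp add: distinct_grid)
    moreover have "k \<le> card {b \<in> {b \<in> D. fst b < k}. snd b = j}"
    proof -
      have "(\<lambda>i. (i, j)) ` {..<k} \<subseteq> {b \<in> {b \<in> D. fst b < k}. snd b = j}"
        using ideal_le[OF i True] by auto
      from card_mono[OF _ this] show ?thesis using fin by (simp add: card_image inj_on_def)
    qed
    ultimately show ?thesis by simp
  next
    case False
    have "{b \<in> ?X. snd b = j} \<subseteq> {b \<in> {b \<in> D. fst b < k}. snd b = j}"
    proof
      fix b assume b: "b \<in> {b \<in> ?X. snd b = j}"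
      then have "(fst b, j) \<in> D" using X by force
      then have "fst b < k" using False ideal_le[OF i, of "fst b" j k j] by force
      then show "b \<in> {b \<in> {b \<in> D. fst b < k}. snd b = j}" using b X by blast
    qed
    then show ?thesis using fin by (intro card_mono) auto
  qed
  have "card S = card ?X" using card_image[OF inj] by simp
  also have "\<dots> = (\<Sum>j<N. card {b \<in> ?X. snd b = j})"
    by (rule card_columns) (use finite_subset[OF X fin] X N in auto)
  also have "\<dots> \<le> (\<Sum>j<N. card {b \<in> {b \<in> D. fst b < k}. snd b = j})" by (intro sum_mono col)
  also have "\<dots> = card {b \<in> D. fst b < k}" using N fin by (intro card_columns[symmetric]) auto
  finally show ?thesis .
qed

text \<open>The entries of the first \<open>k\<close> rows attain the bound: within a row they are
  read in increasing order, so a decreasing chain meets each row at most once.\<close>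

lemma dec_bounded_tableau_exists:
  assumes g: "grows {} T D" and N: "D \<subseteq> {..<N} \<times> {..<N}"
  shows "\<exists>S \<subseteq> {..<length T}. dec_bounded k S (word N (numbering T)) \<and> card S = card {b \<in> D. fst b < k}"
proof (intro exI conjI)
  let ?S = "{m. m < length T \<and> fst (T ! m) < k}"
  have D: "D = set T" and d: "distinct T" using grows_set[OF g] by auto
  show "?S \<subseteq> {..<length T}" by auto
  have "(!) T ` ?S = {b \<in> D. fst b < k}" 
    by (fastforce simp: D in_set_conv_nth image_iff)
  moreover have "inj_on ((!) T) ?S" using d by (intro inj_on_nth) auto
  ultimately show "card ?S = card {b \<in> D. fst b < k}" using card_image by fastforce
  show "dec_bounded k ?S (word N (numbering T))"
    unfolding dec_bounded_def
  proof (intro allI impI, elim conjE)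
    fix C assume C: "subseq C (word N (numbering T))" "sorted_wrt (>) C" "set C \<subseteq> ?S"
    have "sorted_wrt (\<lambda>a b. before (T ! a) (T ! b)) (word N (numbering T))"
      using N D nth_numbering[OF d] by (subst sorted_wrt_word) auto
    from subseq_sorted_wrt[OF C(1) this]
    have bef: "before (T ! (C ! p)) (T ! (C ! q))" if "p < q" "q < length C" for p q
      using that by (simp add: sorted_wrt_iff_nth_less)
    have less: "C ! q < C ! p" if "p < q" "q < length C" for p q
      using that C(2) by (simp add: sorted_wrt_iff_nth_less)
    have ne: "fst (T ! (C ! p)) \<noteq> fst (T ! (C ! q))" if pq: "p < q" "q < length C" for p q
    proof
      assume eq: "fst (T ! (C ! p)) = fst (T ! (C ! q))"
      have m: "C ! p < length T" "C ! q < length T" using pq C(3) nth_mem[of p C] nth_mem[of q C] less_trans by blast+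
      have "C ! p < C ! q"
        by (rule grows_less_nth[OF g m])
          (use bef[OF pq] less[OF pq] eq in \<open>auto simp: before_def\<close>)
      then show False using less[OF pq] by simp
    qed
    have "inj_on (\<lambda>p. fst (T ! (C ! p))) {..<length C}"
      using ne by (auto simp: inj_on_def) (metis linorder_neqE_nat)
    moreover have "(\<lambda>p. fst (T ! (C ! p))) ` {..<length C} \<subseteq> {..<k}"
      using C(3) nth_mem by fastforce
    ultimately have "card {..<length C} \<le> card {..<k}" by (rule card_inj_on_le) simp
    then show "length C \<le> k" by simp
  qed
qed

text \<open>An optimal set for \<open>T\<close> is carried along the Knuth class to an admissible
  set of the same size for \<open>T'\<close>, where the column bound applies.\<close>

lemma knuth_shape_le:
  assumes "grows {} T D" "grows {} T' D'" "D \<subseteq> {..<N} \<times> {..<N}" "D' \<subseteq> {..<N} \<times> {..<N}"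
    "knuth (word N (numbering T)) (word N (numbering T'))"
  shows "card {b \<in> D. fst b < k} \<le> card {b \<in> D'. fst b < k}"
proof -
  have d: "distinct T" "distinct T'" "D = set T" "D' = set T'" using assms(1,2) grows_set by blast+
  have sw: "set (word N (numbering T)) = {..<length T}" "set (word N (numbering T')) = {..<length T'}"
    using set_word_numbering d assms(3,4) by blast+
  then have len: "{..<length T} = {..<length T'}" using knuth_mset[OF assms(5)] mset_eq_setD by metis
  obtain S where S: "S \<subseteq> {..<length T}" "dec_bounded k S (word N (numbering T))" "card S = card {b \<in> D. fst b < k}"
    using dec_bounded_tableau_exists[OF assms(1,3)] by blast
  obtain S' where "S' \<subseteq> {..<length T}" "card S' = card S" "dec_bounded k S' (word N (numbering T'))"
    using dec_bounded_knuth[OF assms(5) distinct_word_numbering[OF d(1)] _ S(2)] S(1) sw by auto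
  then show ?thesis using dec_bounded_tableau_le[OF assms(2,4)] S(3) len by metis
qed

lemma knuth_shape:
  assumes "grows {} T D" "grows {} T' D'" "D \<subseteq> {..<N} \<times> {..<N}" "D' \<subseteq> {..<N} \<times> {..<N}"
    "knuth (word N (numbering T)) (word N (numbering T'))"
  shows "D = D'"
proof (rule ideal_eqI)
  show "card {b \<in> D. fst b < k} = card {b \<in> D'. fst b < k}" for k
    by (rule le_antisym[OF knuth_shape_le[OF assms] knuth_shape_le[OF assms(2,1,4,3) equivclp_sym[OF assms(5)]]])
qed (rule grows_idealD(2)[OF assms(1)] grows_idealD(2)[OF assms(2)])+

lemma word_take:
  assumes "distinct T" "set T \<subseteq> {..<N} \<times> {..<N}"
  shows "word N (numbering (take m T)) = filter (\<lambda>a. a < m) (word N (numbering T))"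
proof -
  have d: "distinct (take m T)" using assms(1) by simp
  have 1: "b \<in> set (take m T) \<longleftrightarrow> b \<in> set T \<and> the (numbering T b) < m" for b
  proof
    assume "b \<in> set (take m T)"
    then obtain p where "p < m" "p < length T" "T ! p = b" by (auto simp: in_set_conv_nth)
    then show "b \<in> set T \<and> the (numbering T b) < m" using numbering_nth[OF assms(1), of p] by auto
  next
    assume b: "b \<in> set T \<and> the (numbering T b) < m"
    then obtain p where "p < length T" "T ! p = b" by (auto simp: in_set_conv_nth)
    moreover from this have "p < m" using b numbering_nth[OF assms(1), of p] by auto
    ultimately show "b \<in> set (take m T)" by (auto simp: in_set_conv_nth intro!: exI[of _ p])
  qed
  have 2: "the (numbering (take m T) b) = the (numbering T b)" if b: "b \<in> set (take m T)" for b
  proof -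
    obtain p where "p < m" "p < length T" "T ! p = b" using b by (auto simp: in_set_conv_nth)
    then show ?thesis using numbering_nth[OF assms(1), of p] numbering_nth[OF d, of p] by simp
  qed
  have "word N (numbering (take m T)) = map (the \<circ> numbering T) (filter (\<lambda>b. b \<in> set (take m T)) (grid N))"
    unfolding word_grid using 2 by (auto intro!: map_cong)
  also have "filter (\<lambda>b. b \<in> set (take m T)) (grid N) =
      filter ((\<lambda>a. a < m) \<circ> (the \<circ> numbering T)) (filter (\<lambda>b. b \<in> dom (numbering T)) (grid N))"
    using 1 by (auto intro!: filter_cong)
  finally show ?thesis unfolding word_grid filter_map .
qed

text \<open>Restricting both words to labels below \<open>m\<close> keeps them Knuth equivalent, so
  the subtableaux of these labels have the same shape for every \<open>m\<close>; successive shapes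
  differ by the box labelled \<open>m\<close>.\<close>

lemma knuth_tableau_unique:
  assumes "grows {} T D" "grows {} T' D'" "D \<subseteq> {..<N} \<times> {..<N}" "D' \<subseteq> {..<N} \<times> {..<N}"
    "knuth (word N (numbering T)) (word N (numbering T'))"
  shows "T = T'"
proof -
  have d: "distinct T" "distinct T'" "D = set T" "D' = set T'" using assms(1,2) grows_set by blast+
  have tk: "set (take m T) = set (take m T')" for m
  proof (rule knuth_shape)
    show "grows {} (take m T) (set (take m T))" "grows {} (take m T') (set (take m T'))"
      using assms(1,2) grows_append[of "{}" "take m T" "drop m T" D]
        grows_append[of "{}" "take m T'" "drop m T'" D'] grows_set by fastforce+
    show "set (take m T) \<subseteq> {..<N} \<times> {..<N}" "set (take m T') \<subseteq> {..<N} \<times> {..<N}"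
      using assms(3,4) set_take_subset[of m T] set_take_subset[of m T'] unfolding d(3,4) by auto
    show "knuth (word N (numbering (take m T))) (word N (numbering (take m T')))"
      using knuth_filter_less[OF assms(5), of m] assms(3,4) unfolding d(3,4)
      by (simp add: word_take[OF d(1)] word_take[OF d(2)])
  qed
  have len: "length T = length T'"
    using knuth_shape[OF assms] distinct_card[OF d(1)] distinct_card[OF d(2)] d(3,4) by simp
  show ?thesis
  proof (rule nth_equalityI[OF len])
    fix m assume m: "m < length T"
    have e: "{T ! m} = set (take (Suc m) T) - set (take m T)" if "distinct T" "m < length T" for T :: "(nat \<times> nat) list"
      using that by (auto simp: take_Suc_conv_app_nth in_set_conv_nth nth_eq_iff_index_eq)
    have "{T ! m} = {T' ! m}"
      using e[OF d(1) m] e[OF d(2)] m len tk[of m] tk[of "Suc m"] by simp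
    then show "T ! m = T' ! m" by simp
  qed
qed

section \<open>Rectification and the symmetry of switching\<close>

text \<open>In a nonempty ideal a box with the largest sum of coordinates is an inner
  corner.\<close>

lemma no_inner_corner:
  assumes "order_ideal M" "\<nexists>c. inner_corner M c"
  shows "M = {}"
proof (rule ccontr)
  assume "M \<noteq> {}"
  have fin: "finite M" using idealD(1)[OF assms(1)] .
  define m where "m = Max ((\<lambda>b. fst b + snd b) ` M)"
  have "m \<in> (\<lambda>b. fst b + snd b) ` M" unfolding m_def using fin \<open>M \<noteq> {}\<close> by (intro Max_in) auto
  then obtain c where c: "c \<in> M" "fst c + snd c = m" by auto
  have "fst b + snd b \<le> m" if "b \<in> M" for b using that fin by (auto simp: m_def)
  from this[of "(fst c + 1, snd c)"] this[of "(fst c, snd c + 1)"] c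
  have "inner_corner M c" by (auto simp: inner_corner_def)
  then show False using assms(2) by blast
qed

lemma inner_corner_ideal:
  assumes "order_ideal M" "inner_corner M c"
  shows "order_ideal (M - {c})" "c \<in> M"
proof -
  obtain a b where c: "c = (a, b)" by (cases c)
  show "c \<in> M" using assms(2) by (simp add: inner_corner_def)
  show "order_ideal (M - {c})"
    unfolding order_ideal_def
  proof (intro conjI allI impI)
    show "finite (M - {c})" using idealD(1)[OF assms(1)] by simp
    fix i j
    show "(i, j) \<in> M - {c}" if "(Suc i, j) \<in> M - {c}"
      using that idealD(2)[OF assms(1), of i j] assms(2) by (auto simp: c inner_corner_def)
    show "(i, j) \<in> M - {c}" if "(i, Suc j) \<in> M - {c}"
      using that idealD(3)[OF assms(1), of i j] assms(2) by (auto simp: c inner_corner_def)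
  qed
qed

lemma inner_corner_insert:
  assumes "order_ideal Y" "c \<notin> Y" 
  shows "inner_corner (insert c Y) c"
proof -
  obtain a b where c: "c = (a, b)" by (cases c)
  show ?thesis
    using assms(2) idealD(2)[OF assms(1), of a b] idealD(3)[OF assms(1), of a b]
    by (auto simp: c inner_corner_def)
qed

lemma forward_slide_simulation:
  fixes f :: "nat \<Rightarrow> 'a::linorder"
  assumes "grows M bs L" "L \<subseteq> {..<N} \<times> {..<N}" "inner_corner M c"
    "mono_on {..<length bs} f" "sorted_wrt (consistent f deg) (word N (numbering bs))"
    "slide_list c bs = (bs', c')"
  shows "slide deg c (map_option f \<circ> numbering bs) (map_option f \<circ> numbering bs')"
    "knuth (word N (numbering bs)) (word N (numbering bs'))"
    "grows (M - {c}) (bs' @ [c']) L" "length bs' = length bs"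
proof -
  have g: "grows (M - {c}) (c # bs) L"
    using assms(1) inner_corner_ideal[OF grows_idealD(1)[OF assms(1)] assms(3)]
    by (simp add: insert_absorb)
  from slide_simulation[of "M - {c}" "[]" c bs L N f deg bs' c'] g assms(2,4-6)
  show "slide deg c (map_option f \<circ> numbering bs) (map_option f \<circ> numbering bs')"
    "knuth (word N (numbering bs)) (word N (numbering bs'))" by auto
  from slide_list_grows[OF g assms(6)]
  show "grows (M - {c}) (bs' @ [c']) L" "length bs' = length bs" by auto
qed

text \<open>Whatever corners are chosen, the filling keeps the letter function \<open>f\<close> on
  its labels and the Knuth class of its label word. This is the half needed for uniqueness of the
  rectification.\<close>

lemma forward_slides_simulation:
  fixes f :: "nat \<Rightarrow> 'a::linorder"
  assumes "(forward_slide deg)\<^sup>*\<^sup>* (M, map_option f \<circ> numbering bs) (M', V)"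
    "grows M bs L" "L \<subseteq> {..<N} \<times> {..<N}"
    "mono_on {..<length bs} f" "sorted_wrt (consistent f deg) (word N (numbering bs))"
  shows "\<exists>bs' L'. V = map_option f \<circ> numbering bs' \<and> grows M' bs' L' \<and> L' \<subseteq> {..<N} \<times> {..<N} \<and>
    length bs' = length bs \<and> knuth (word N (numbering bs)) (word N (numbering bs'))"
  using assms(1)
proof (induction "(M', V)" arbitrary: M' V rule: rtranclp_induct)
  case base
  then show ?case using assms(2,3) by (intro exI[of _ bs] exI[of _ L]) simp
next
  case (step s)
  obtain M1 V1 where s: "s = (M1, V1)" by (cases s)
  obtain bs1 L1 where 1: "V1 = map_option f \<circ> numbering bs1" "grows M1 bs1 L1"
    "L1 \<subseteq> {..<N} \<times> {..<N}" "length bs1 = length bs"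
    "knuth (word N (numbering bs)) (word N (numbering bs1))"
    using step.hyps(3)[OF s] by blast
  have d: "distinct bs" "set bs \<subseteq> {..<N} \<times> {..<N}" using grows_set[OF assms(2)] assms(3) by auto
  have m: "mono_on {..<length bs1} f" using assms(4) 1(4) by simp
  have c: "sorted_wrt (consistent f deg) (word N (numbering bs1))"
    by (rule knuth_consistent_map(1)[OF 1(5) _ assms(5)])
      (use set_word_numbering[OF d] assms(4) in simp)
  obtain c where c': "inner_corner M1 c" "slide deg c V1 V" "M' = M1 - {c}"
    using step.hyps(2) unfolding s by (auto elim: forward_slide.cases)
  obtain bs2 c2 where sl: "slide_list c bs1 = (bs2, c2)" by (cases "slide_list c bs1") blast
  note F = forward_slide_simulation[OF 1(2,3) c'(1) m c sl]
  obtain L2 where L2: "grows M' bs2 L2" "grows L2 [c2] L1" using F(3) unfolding grows_append c'(3) by blast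
  have "L2 \<subseteq> L1" using grows_set[OF L2(2)] by blast
  moreover have "V = map_option f \<circ> numbering bs2"
    using slide_deterministic F(1) c'(2) 1(1) by metis
  ultimately show ?case
    using L2(1) 1(3,4) F(4) equivclp_trans[OF 1(5) F(2)] by (intro exI[of _ bs2] exI[of _ L2]) auto
qed

text \<open>Read backwards, \<open>cs\<close> is a legal sequence of inner corners:
  \<open>switch\<close> first slides into the box that \<open>cs\<close> adds last.\<close>

lemma switch_simulation:
  fixes f :: "nat \<Rightarrow> 'a::linorder"
  assumes "grows Y (cs @ bs) L" "L \<subseteq> {..<N} \<times> {..<N}"
    "mono_on {..<length bs} f" "sorted_wrt (consistent f deg) (word N (numbering bs))"
  shows "(forward_slide deg)\<^sup>*\<^sup>* (Y \<union> set cs, map_option f \<circ> numbering bs)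
      (Y, map_option f \<circ> numbering (fst (switch cs bs)))
    \<and> knuth (word N (numbering bs)) (word N (numbering (fst (switch cs bs))))"
  using assms(1)
proof (induction cs arbitrary: Y)
  case (Cons c cs)
  obtain bs1 cs1 where sw: "switch cs bs = (bs1, cs1)" by (cases "switch cs bs") blast
  obtain bs2 c2 where sl: "slide_list c bs1 = (bs2, c2)" by (cases "slide_list c bs1") blast
  have g: "grows (insert c Y) (cs @ bs) L" "order_ideal Y" "c \<notin> Y" using Cons.prems by auto
  note sg = switch_grows[OF g(1) sw]
  then obtain L1 where L1: "grows (insert c Y) bs1 L1" "grows L1 cs1 L" unfolding grows_append by blast
  have L1N: "L1 \<subseteq> {..<N} \<times> {..<N}" using grows_set[OF L1(2)] assms(2) by blast
  have IH: "(forward_slide deg)\<^sup>*\<^sup>* (insert c Y \<union> set cs, map_option f \<circ> numbering bs)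
      (insert c Y, map_option f \<circ> numbering bs1)"
    "knuth (word N (numbering bs)) (word N (numbering bs1))"
    using Cons.IH[OF g(1)] unfolding sw fst_conv by blast+
  have "L = (insert c Y \<union> set cs) \<union> set bs" "distinct bs"
    using grows_set[OF g(1)] by auto
  then have d: "distinct bs" "set bs \<subseteq> {..<N} \<times> {..<N}" using assms(2) by auto
  have c: "sorted_wrt (consistent f deg) (word N (numbering bs1))"
    by (rule knuth_consistent_map(1)[OF IH(2) _ assms(4)])
      (use set_word_numbering[OF d] assms(3) in simp)
  have ic: "inner_corner (insert c Y) c" using inner_corner_insert g by blast
  have "mono_on {..<length bs1} f" using assms(3) sg by simp
  note F = forward_slide_simulation[OF L1(1) L1N ic this c sl]
  have "forward_slide deg (insert c Y, map_option f \<circ> numbering bs1) (insert c Y - {c}, map_option f \<circ> numbering bs2)"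
    by (rule forward_slide.intros[OF ic F(1)])
  moreover have "insert c Y - {c} = Y" using g(3) by blast
  ultimately have "(forward_slide deg)\<^sup>*\<^sup>* (insert c Y \<union> set cs, map_option f \<circ> numbering bs)
      (Y, map_option f \<circ> numbering bs2)"
    using IH(1) by (metis (no_types, lifting) rtranclp.rtrancl_into_rtrancl)
  moreover have "insert c Y \<union> set cs = Y \<union> set (c # cs)" by auto
  moreover have "fst (switch (c # cs) bs) = bs2" using sw sl by simp
  ultimately show ?case using equivclp_trans[OF IH(2) F(2)] by (simp add: comp_def)
qed simp

lemma switch_tableau:
  assumes "grows {} (cs @ bs) L"
  obtains D where "grows {} (fst (switch cs bs)) D" "D \<subseteq> L" "length (fst (switch cs bs)) = length bs"
proof -
  obtain bs1 cs1 where sw: "switch cs bs = (bs1, cs1)" by (cases "switch cs bs") blast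
  note sg = switch_grows[OF assms sw]
  then obtain D where "grows {} bs1 D" "grows D cs1 L" unfolding grows_append by blast
  then show thesis using that[of D] sg grows_set[of D cs1 L] sw by auto
qed

text \<open>One direction exhibits the rectification along \<open>cs\<close>. In the other, any
  rectification comes from a straight standard tableau in the same Knuth class, which is unique; no
  local confluence of slides has to be examined.\<close>

lemma rectifies_to_switch:
  fixes f :: "nat \<Rightarrow> 'a::linorder"
  assumes cs: "grows {} cs (diagram mu)" and bs: "grows (diagram mu) bs L"
    and N: "L \<subseteq> {..<N} \<times> {..<N}"
    and m: "mono_on {..<length bs} f" and c: "sorted_wrt (consistent f deg) (word N (numbering bs))"
  shows "rectifies_to deg mu (map_option f \<circ> numbering bs) t
    \<longleftrightarrow> t = map_option f \<circ> numbering (fst (switch cs bs))"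
proof
  have g: "grows {} (cs @ bs) L" using cs bs unfolding grows_append by blast
  have mu: "{} \<union> set cs = diagram mu" using grows_set[OF cs] by simp
  note S = switch_simulation[OF g N m c, unfolded mu]
  { assume "rectifies_to deg mu (map_option f \<circ> numbering bs) t"
    then obtain M where M: "(forward_slide deg)\<^sup>*\<^sup>* (diagram mu, map_option f \<circ> numbering bs) (M, t)"
      "\<nexists>c. inner_corner M c" unfolding rectifies_to_def by blast
    obtain T D where T: "t = map_option f \<circ> numbering T" "grows M T D" "D \<subseteq> {..<N} \<times> {..<N}"
      "knuth (word N (numbering bs)) (word N (numbering T))"
      using forward_slides_simulation[OF M(1) bs N m c] by blast
    have "M = {}" using no_inner_corner[OF grows_idealD(1)[OF T(2)] M(2)] .
    obtain E where E: "grows {} (fst (switch cs bs)) E" "E \<subseteq> L" by (rule switch_tableau[OF g])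
    have "T = fst (switch cs bs)"
      by (rule knuth_tableau_unique[OF T(2)[unfolded \<open>M = {}\<close>] E(1) T(3) order_trans[OF E(2) N]])
        (use S T(4) equivclp_sym equivclp_trans in metis)
    then show "t = map_option f \<circ> numbering (fst (switch cs bs))" using T(1) by simp }
  { assume "t = map_option f \<circ> numbering (fst (switch cs bs))"
    then show "rectifies_to deg mu (map_option f \<circ> numbering bs) t"
      unfolding rectifies_to_def using S by (intro exI[of _ "{}"]) (auto simp: inner_corner_def) }
qed

lemma Rect_switch:
  fixes f :: "nat \<Rightarrow> 'a::linorder"
  assumes "grows {} cs (diagram mu)" "grows (diagram mu) bs L" "L \<subseteq> {..<N} \<times> {..<N}"
    "mono_on {..<length bs} f" "sorted_wrt (consistent f deg) (word N (numbering bs))"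
  shows "Rect deg mu (map_option f \<circ> numbering bs) = map_option f \<circ> numbering (fst (switch cs bs))"
  unfolding Rect_def rectifies_to_switch[OF assms] by simp

lemma switch_knuth:
  assumes cs: "grows {} cs M" and bs: "grows M bs L" and N: "L \<subseteq> {..<N} \<times> {..<N}"
  shows "knuth (word N (numbering bs)) (word N (numbering (fst (switch cs bs))))"
proof -
  have g: "grows {} (cs @ bs) L" using cs bs unfolding grows_append by blast
  \<comment> \<open>The labels serve as their own letters. Since they are distinct, any degree
    function is consistent, here the constant 0.\<close>
  have m: "mono_on {..<length bs} (id :: nat \<Rightarrow> nat)" by (simp add: mono_on_def)
  have d: "distinct bs" using grows_set[OF bs] by blast
  have c: "sorted_wrt (consistent (id :: nat \<Rightarrow> nat) (\<lambda>_. 0)) (word N (numbering bs))"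
    by (rule consistent_inj[OF d inj_on_id])
  show ?thesis using switch_simulation[OF g N m c] by blast
qed

lemma switch_confluent:
  assumes "grows {} cs M" "grows {} cs' M" "grows M bs L"
  shows "fst (switch cs bs) = fst (switch cs' bs)"
proof -
  obtain N where N: "L \<subseteq> {..<N} \<times> {..<N}" using ideal_bounded grows_idealD(2)[OF assms(3)] by blast
  have g: "grows {} (cs @ bs) L" "grows {} (cs' @ bs) L"
    using assms unfolding grows_append by blast+
  obtain D where D: "grows {} (fst (switch cs bs)) D" "D \<subseteq> L" by (rule switch_tableau[OF g(1)])
  obtain D' where D': "grows {} (fst (switch cs' bs)) D'" "D' \<subseteq> L" by (rule switch_tableau[OF g(2)])
  have "knuth (word N (numbering (fst (switch cs bs)))) (word N (numbering (fst (switch cs' bs))))"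
    using switch_knuth[OF assms(1,3) N] switch_knuth[OF assms(2,3) N] equivclp_sym equivclp_trans by metis
  from knuth_tableau_unique[OF D(1) D'(1) _ _ this] show ?thesis using D(2) D'(2) N by blast
qed

section \<open>Symmetry of the count of standard tableaux\<close>

definition std_count :: "(nat \<times> nat) set \<Rightarrow> (nat \<times> nat) set \<Rightarrow> (nat \<times> nat) list \<Rightarrow> (nat \<times> nat) list \<Rightarrow> nat" where
  "std_count M L cs T = card {bs. grows M bs L \<and> fst (switch cs bs) = T}"

lemma std_count_symmetric:
  assumes cs: "grows {} cs M" and T: "grows {} T D"
  shows "std_count M L cs T = std_count D L T cs"
  unfolding std_count_def
proof (rule bij_betw_same_card)
  \<comment> \<open>Stated for all \<open>cs\<close> and \<open>T\<close>, because the inverse map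
    is the same construction with these two exchanged.\<close>
  have sw: "grows D (snd (switch cs bs)) L \<and> switch T (snd (switch cs bs)) = (cs, bs)"
    if cs: "grows {} cs M" and T: "grows {} T D" and bs: "grows M bs L" "fst (switch cs bs) = T"
    for cs T bs M D
  proof -
    obtain cs' where s: "switch cs bs = (T, cs')" using bs(2) by (cases "switch cs bs") auto
    have "grows {} (cs @ bs) L" using cs bs(1) unfolding grows_append by blast
    note sg = switch_grows[OF this s]
    then obtain E where E: "grows {} T E" "grows E cs' L" unfolding grows_append by blast
    have "E = D" using grows_set[OF E(1)] grows_set[OF T] by simp
    then show ?thesis using E(2) sg s by simp
  qed
  show "bij_betw (\<lambda>bs. snd (switch cs bs)) {bs. grows M bs L \<and> fst (switch cs bs) = T}
      {ds. grows D ds L \<and> fst (switch T ds) = cs}"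
  proof (rule bij_betw_byWitness[where f' = "\<lambda>ds. snd (switch T ds)"])
    show "\<forall>bs\<in>{bs. grows M bs L \<and> fst (switch cs bs) = T}. snd (switch T (snd (switch cs bs))) = bs"
      using sw[OF cs T] by auto
    show "\<forall>ds\<in>{ds. grows D ds L \<and> fst (switch T ds) = cs}. snd (switch cs (snd (switch T ds))) = ds"
      using sw[OF T cs] by auto
    show "(\<lambda>bs. snd (switch cs bs)) ` {bs. grows M bs L \<and> fst (switch cs bs) = T}
      \<subseteq> {ds. grows D ds L \<and> fst (switch T ds) = cs}"
      using sw[OF cs T] by auto
    show "(\<lambda>ds. snd (switch T ds)) ` {ds. grows D ds L \<and> fst (switch T ds) = cs}
      \<subseteq> {bs. grows M bs L \<and> fst (switch cs bs) = T}"
      using sw[OF T cs] by auto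
  qed
qed

lemma std_count_shape:
  assumes cs: "grows {} cs M" and cs': "grows {} cs' M" and T: "grows {} T D" and T': "grows {} T' D"
  shows "std_count M L cs T = std_count M L cs' T'"
proof -
  have "std_count M L cs T = std_count M L cs' T" for T
    unfolding std_count_def using switch_confluent[OF cs cs'] by (intro arg_cong[of _ _ card]) auto
  moreover have "std_count D L T cs = std_count D L T' cs" 
    unfolding std_count_def using switch_confluent[OF T T'] by (intro arg_cong[of _ _ card]) auto
  ultimately show ?thesis using std_count_symmetric[OF cs T] std_count_symmetric[OF cs T'] by metis
qed

section \<open>Standardization\<close>

text \<open>Increases along the row reading. The bottom row of the grid has factor 1 rather than 0,
  and \<open>N * N + N\<close> is a convenient upper bound.\<close>

definition reading_index :: "nat \<Rightarrow> nat \<times> nat \<Rightarrow> nat" where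
  "reading_index N b = (N - fst b) * N + snd b"

lemma reading_index_less:
  assumes "before b c" "b \<in> {..<N} \<times> {..<N}" "c \<in> {..<N} \<times> {..<N}"
  shows "reading_index N b < reading_index N c"
proof (cases "fst b = fst c")
  case True
  then show ?thesis using assms(1) by (auto simp: before_def reading_index_def)
next
  case False
  then have "fst c < fst b" using assms(1) by (auto simp: before_def)
  then have "Suc (N - fst b) \<le> N - fst c" using assms(2) by auto
  then have "Suc (N - fst b) * N \<le> (N - fst c) * N" by (rule mult_le_mono1)
  moreover have "snd b < N" using assms(2) by auto
  ultimately show ?thesis by (simp add: reading_index_def)
qed

lemma reading_index_le: "b \<in> {..<N} \<times> {..<N} \<Longrightarrow> reading_index N b \<le> N * N + N"
  unfolding reading_index_def by (intro add_mono mult_le_mono1) auto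

lemma before_total: "b \<noteq> c \<Longrightarrow> before b c \<or> before c b"
  by (auto simp: before_def prod_eq_iff)

text \<open>Sorting by this key in lexicographic order is standardization: by letter, then in
  reading order for degree 0 and against it for degree 1. Subtraction from the bound on
  \<open>reading_index\<close> reverses the order without truncation.\<close>

definition std_key :: "nat \<Rightarrow> ('a \<Rightarrow> nat) \<Rightarrow> 'a filling \<Rightarrow> nat \<times> nat \<Rightarrow> 'a \<times> nat" where
  "std_key N deg U b = (the (U b),
    if deg (the (U b)) = 0 then reading_index N b else N * N + N - reading_index N b)"

lemma inj_on_std_key:
  assumes "D \<subseteq> {..<N} \<times> {..<N}"
  shows "inj_on (std_key N deg U) D"
proof (rule inj_onI, rule ccontr)
  fix b c assume bc: "b \<in> D" "c \<in> D" "std_key N deg U b = std_key N deg U c" "b \<noteq> c"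
  have g: "b \<in> {..<N} \<times> {..<N}" "c \<in> {..<N} \<times> {..<N}" using bc assms by auto
  have "reading_index N b = reading_index N c"
    using bc(3) reading_index_le[OF g(1)] reading_index_le[OF g(2)]
    by (auto simp: std_key_def split: if_splits)
  then show False
    using before_total[OF bc(4)] reading_index_less[OF _ g] reading_index_less[OF _ g(2,1)] by force
qed

text \<open>For equal letters, consistency makes the labels follow the reading order in degree 0 and
  reverse it in degree 1, just as the keys do. As keys are distinct on boxes, the filling then
  determines the list.\<close>

lemma standardization_sorted:
  fixes f :: "nat \<Rightarrow> 'a::linorder"
  assumes d: "distinct bs" and N: "set bs \<subseteq> {..<N} \<times> {..<N}"
    and m: "mono_on {..<length bs} f" and c: "sorted_wrt (consistent f deg) (word N (numbering bs))"
  shows "sorted (map (std_key N deg (map_option f \<circ> numbering bs)) bs)"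
  unfolding sorted_wrt_iff_nth_less length_map
proof (intro allI impI)
  fix p q assume pq: "p < q" "q < length bs"
  let ?U = "map_option f \<circ> numbering bs"
  have n: "numbering bs (bs ! p) = Some p" "numbering bs (bs ! q) = Some q"
    using numbering_nth[OF d] pq by auto
  have mem: "bs ! p \<in> set bs" "bs ! q \<in> set bs" and ne: "bs ! p \<noteq> bs ! q"
    using pq d by (auto simp: nth_eq_iff_index_eq)
  have g: "bs ! p \<in> {..<N} \<times> {..<N}" "bs ! q \<in> {..<N} \<times> {..<N}" using mem N by auto
  have le: "f p \<le> f q" using m pq by (auto simp: mono_on_def)
  note cw = sorted_wrt_word[of "numbering bs" N, THEN iffD1, OF _ c, unfolded dom_numbering, OF N, rule_format]
  have "std_key N deg ?U (bs ! p) \<le> std_key N deg ?U (bs ! q)"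
  proof (cases "f p = f q")
    case True
    from before_total[OF ne] show ?thesis
    proof
      assume b: "before (bs ! p) (bs ! q)"
      have "deg (f p) = 0" using cw[of "bs ! p" "bs ! q"] mem b n True pq by (simp add: consistent_def)
      then show ?thesis using True n reading_index_less[OF b g] by (simp add: std_key_def)
    next
      assume b: "before (bs ! q) (bs ! p)"
      have "deg (f p) = 1" using cw[of "bs ! q" "bs ! p"] mem b n True pq by (simp add: consistent_def)
      then show ?thesis using True n reading_index_less[OF b g(2,1)] by (simp add: std_key_def)
    qed
  next
    case False
    then have "f p < f q" using le by simp
    then show ?thesis using n by (simp add: std_key_def)
  qed
  then show "map (std_key N deg ?U) bs ! p \<le> map (std_key N deg ?U) bs ! q" using pq by simp
qed

lemma standardization_unique:
  fixes f g :: "nat \<Rightarrow> 'a::linorder"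
  assumes "distinct bs" "set bs \<subseteq> {..<N} \<times> {..<N}" "distinct bs'" "set bs' \<subseteq> {..<N} \<times> {..<N}"
    "mono_on {..<length bs} f" "sorted_wrt (consistent f deg) (word N (numbering bs))"
    "mono_on {..<length bs'} g" "sorted_wrt (consistent g deg) (word N (numbering bs'))"
    and eq: "map_option f \<circ> numbering bs = map_option g \<circ> numbering bs'"
  shows "bs = bs'" "\<And>p. p < length bs \<Longrightarrow> f p = g p"
proof -
  have s: "set bs = set bs'"
    using arg_cong[OF eq, of dom] dom_numbering[of bs] dom_numbering[of bs'] by (simp add: dom_def)
  have inj: "inj_on (std_key N deg (map_option f \<circ> numbering bs)) (set bs \<union> set bs')"
    using assms(2,4) by (intro inj_on_std_key) auto
  show "bs = bs'"
  proof (rule map_sorted_distinct_set_unique[OF inj])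
    show "sorted (map (std_key N deg (map_option f \<circ> numbering bs)) bs)"
      by (rule standardization_sorted[OF assms(1,2,5,6)])
    show "sorted (map (std_key N deg (map_option f \<circ> numbering bs)) bs')"
      unfolding eq by (rule standardization_sorted[OF assms(3,4,7,8)])
  qed (use assms(1,3) inj s in \<open>auto simp: distinct_map\<close>)
  then show "f p = g p" if "p < length bs" for p
    using fun_cong[OF eq, of "bs ! p"] numbering_nth[OF assms(1) that] by simp
qed

lemma standardization_exists:
  fixes A :: "'a::linorder set"
  assumes A: "finite_signed_alphabet A deg" and lam: "is_partition lam" and mu: "is_partition mu"
    and sub: "diagram mu \<subseteq> diagram lam" and N: "diagram lam \<subseteq> {..<N} \<times> {..<N}"
    and U: "U \<in> super_skew_tableaux A deg lam mu"
  obtains bs f where "grows (diagram mu) bs (diagram lam)" "U = map_option f \<circ> numbering bs"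
    "mono_on {..<length bs} f" "sorted_wrt (consistent f deg) (word N (numbering bs))"
    "f ` {..<length bs} \<subseteq> A"
proof -
  have domU: "dom U = diagram lam - diagram mu" and ranU: "ran U \<subseteq> A"
    and right: "\<And>i j x y. U (i, j) = Some x \<Longrightarrow> U (i, Suc j) = Some y \<Longrightarrow> x \<le> y \<and> (x = y \<longrightarrow> deg x = 0)"
    and below: "\<And>i j x y. U (i, j) = Some x \<Longrightarrow> U (Suc i, j) = Some y \<Longrightarrow> x \<le> y \<and> (x = y \<longrightarrow> deg x = 1)"
    using U by (auto simp: super_skew_tableaux_def)
  have ideals: "order_ideal (diagram lam)" "order_ideal (diagram mu)" using lam mu ideal_diagram by blast+
  have fin: "finite (dom U)" using domU idealD(1)[OF ideals(1)] by simp
  obtain xs where xs: "set xs = dom U" "distinct xs" using finite_distinct_list[OF fin] by blast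
  define key where "key = std_key N deg U"
  define bs where "bs = sort_key key xs"
  have bs: "set bs = dom U" "distinct bs" using xs by (simp_all add: bs_def)
  have srt: "key (bs ! p) \<le> key (bs ! q)" if "p \<le> q" "q < length bs" for p q
    using sorted_nth_mono[of "map key bs" p q] that by (simp add: bs_def)
  define f where "f m = the (U (bs ! m))" for m
  have Us: "U (bs ! p) = Some (f p)" if "p < length bs" for p
    using bs(1) nth_mem[OF that] by (auto simp: f_def)
  have gr: "bs ! p \<in> {..<N} \<times> {..<N}" if "p < length bs" for p
    using bs(1) domU N nth_mem[OF that] by auto
  have fA: "f p \<in> A" if "p < length bs" for p using Us[OF that] ranU ranI subsetD by metis
  have degs: "deg (f p) = 0 \<or> deg (f p) = 1" if "p < length bs" for p
    using fA[OF that] A by (auto simp: finite_signed_alphabet_def)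
  have keyf: "key (bs ! p) = (f p, if deg (f p) = 0 then reading_index N (bs ! p)
      else N * N + N - reading_index N (bs ! p))" for p
    by (simp add: key_def std_key_def f_def)
  have "grows (diagram mu) bs (diagram mu \<union> set bs)"
  proof (rule growsI)
    show "order_ideal (diagram mu)" by (rule ideals)
    show "diagram mu \<inter> set bs = {}" using bs domU by auto
    show "order_ideal (diagram mu \<union> set bs)" using bs domU sub ideals by (simp add: Un_absorb1)
    fix p q assume pq: "p < length bs" "q < length bs" "adj (bs ! p) (bs ! q)"
    obtain i j where ij: "bs ! p = (i, j)" by (cases "bs ! p")
    \<comment> \<open>Equal letters in neighbouring boxes have degree 1 vertically, where the lower
      box is read earlier and the reversed index grows, and degree 0 horizontally, where the index
      itself grows.\<close>
    have "key (bs ! p) < key (bs ! q)"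
      using pq(3) unfolding adj_def
    proof
      assume b: "bs ! q = (Suc (fst (bs ! p)), snd (bs ! p))"
      then have "f p \<le> f q \<and> (f p = f q \<longrightarrow> deg (f p) = 1)"
        using below[of i j "f p" "f q"] Us[OF pq(1)] Us[OF pq(2)] ij by simp
      moreover have "before (bs ! q) (bs ! p)" using b by (simp add: before_def)
      then have "reading_index N (bs ! q) < reading_index N (bs ! p)"
        using gr pq(1,2) by (intro reading_index_less)
      moreover have "reading_index N (bs ! p) \<le> N * N + N"
        using gr pq(1) by (intro reading_index_le)
      ultimately show ?thesis unfolding keyf by (cases "f p = f q") auto
    next
      assume b: "bs ! q = (fst (bs ! p), Suc (snd (bs ! p)))"
      then have "f p \<le> f q \<and> (f p = f q \<longrightarrow> deg (f p) = 0)"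
        using right[of i j "f p" "f q"] Us[OF pq(1)] Us[OF pq(2)] ij by simp
      moreover have "before (bs ! p) (bs ! q)" using b by (simp add: before_def)
      then have "reading_index N (bs ! p) < reading_index N (bs ! q)"
        using gr pq(1,2) by (intro reading_index_less)
      ultimately show ?thesis unfolding keyf by (cases "f p = f q") auto
    qed
    then show "p < q" using srt[of q p] pq(1) by (meson leD not_le)
  qed (rule bs)
  moreover have "diagram mu \<union> set bs = diagram lam" using bs domU sub by auto
  moreover have "U = map_option f \<circ> numbering bs"
  proof (rule ext)
    fix b
    show "U b = (map_option f \<circ> numbering bs) b"
    proof (cases "b \<in> set bs")
      case True
      then obtain p where "p < length bs" "bs ! p = b" by (auto simp: in_set_conv_nth)
      then show ?thesis using Us[of p] numbering_nth[OF bs(2), of p] by simp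
    next
      case False
      then show ?thesis using bs(1) numbering_eq_None[of bs b] by auto
    qed
  qed
  moreover have "mono_on {..<length bs} f"
  proof (rule mono_onI)
    fix p q assume "p \<in> {..<length bs}" "q \<in> {..<length bs}" "p \<le> q"
    then show "f p \<le> f q" using srt[of p q] unfolding keyf by auto
  qed
  moreover have "sorted_wrt (consistent f deg) (word N (numbering bs))"
  proof (subst sorted_wrt_word)
    show "dom (numbering bs) \<subseteq> {..<N} \<times> {..<N}" using bs domU N by auto
    show "\<forall>b c. b \<in> dom (numbering bs) \<and> c \<in> dom (numbering bs) \<and> before b c \<longrightarrow>
      consistent f deg (the (numbering bs b)) (the (numbering bs c))"
    proof (intro allI impI, elim conjE)
      fix b c assume "b \<in> dom (numbering bs)" "c \<in> dom (numbering bs)" and bef: "before b c"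
      then have "b \<in> set bs" "c \<in> set bs" unfolding dom_numbering by blast+
      then obtain p q where pq: "p < length bs" "bs ! p = b" "q < length bs" "bs ! q = c"
        by (auto simp: in_set_conv_nth)
      have ri: "reading_index N b < reading_index N c" "reading_index N c \<le> N * N + N"
        using reading_index_less[OF bef] reading_index_le[of c N] gr pq by auto
      have "deg (f p) = (if p < q then 0 else 1)" if eq: "f p = f q"
      proof (cases "p < q")
        case True
        then show ?thesis using srt[of p q] pq eq ri degs[of p] unfolding keyf by auto
      next
        case False
        then show ?thesis using srt[of q p] pq eq ri degs[of p] unfolding keyf by auto
      qed
      then show "consistent f deg (the (numbering bs b)) (the (numbering bs c))"
        using pq numbering_nth[OF bs(2)] by (auto simp: consistent_def)
    qed
  qed
  moreover have "f ` {..<length bs} \<subseteq> A" using fA by auto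
  ultimately show thesis using that[of bs f] by simp
qed

lemma straight_standardization_exists:
  fixes A :: "'a::linorder set"
  assumes "finite_signed_alphabet A deg" "is_partition nu" "diagram nu \<subseteq> {..<K} \<times> {..<K}"
    "t \<in> super_tableaux A deg nu"
  obtains T f where "grows {} T (diagram nu)" "t = map_option f \<circ> numbering T"
    "mono_on {..<length T} f" "sorted_wrt (consistent f deg) (word K (numbering T))"
    "f ` {..<length T} \<subseteq> A"
proof -
  have e: "diagram empty_partition = {}" by (simp add: diagram_def)
  show thesis
    by (rule standardization_exists[OF assms(1,2) _ _ assms(3,4)])
      (use that e in \<open>auto simp: is_partition_def monotone_def\<close>)
qed

lemma super_skew_tableau_of_standard:
  fixes f :: "nat \<Rightarrow> 'a::linorder"
  assumes g: "grows (diagram mu) bs (diagram lam)" and N: "diagram lam \<subseteq> {..<N} \<times> {..<N}"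
    and m: "mono_on {..<length bs} f" and c: "sorted_wrt (consistent f deg) (word N (numbering bs))"
    and A: "f ` {..<length bs} \<subseteq> A"
  shows "map_option f \<circ> numbering bs \<in> super_skew_tableaux A deg lam mu"
proof -
  let ?U = "map_option f \<circ> numbering bs"
  have L: "diagram lam = diagram mu \<union> set bs" "diagram mu \<inter> set bs = {}" and d: "distinct bs"
    using grows_set[OF g] by auto
  have Us: "\<exists>p. p < length bs \<and> bs ! p = b \<and> numbering bs b = Some p \<and> x = f p" if "?U b = Some x" for b x
    using that numbering_eq_Some[OF d] by auto
  have sN: "dom (numbering bs) \<subseteq> {..<N} \<times> {..<N}" using L N by auto
  note cw = sorted_wrt_word[OF sN, THEN iffD1, OF c, rule_format]
  \<comment> \<open>For adjacent boxes, \<open>before b b'\<close> says that \<open>b'\<close> is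
    the right neighbour; a box below is read earlier.\<close>
  have step: "x \<le> y \<and> (x = y \<longrightarrow> deg x = (if before b b' then 0 else 1))"
    if U: "?U b = Some x" "?U b' = Some y" and adj: "adj b b'" for b b' x y
  proof -
    obtain p where p: "p < length bs" "bs ! p = b" "numbering bs b = Some p" "x = f p" using Us[OF U(1)] by blast
    obtain q where q: "q < length bs" "bs ! q = b'" "numbering bs b' = Some q" "y = f q" using Us[OF U(2)] by blast
    have "p \<noteq> q" using adj p q by (auto simp: adj_def prod_eq_iff)
    then have lt: "p < q"
      by (rule grows_less_nth[OF g p(1) q(1)]) (use adj p q in \<open>auto simp: adj_def\<close>)
    have "b \<in> dom (numbering bs)" "b' \<in> dom (numbering bs)" using p q by auto
    then have "if before b b' then consistent f deg p q else consistent f deg q p"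
      using cw[of b b'] cw[of b' b] p q adj by (auto simp: adj_def before_def)
    then show ?thesis
      using m lt p q by (auto simp: consistent_def mono_on_def split: if_splits)
  qed
  have "dom ?U = diagram lam - diagram mu"
    using L dom_numbering[of bs] by (auto simp: dom_def)
  moreover have "ran ?U \<subseteq> A"
  proof
    fix x assume "x \<in> ran ?U"
    then obtain b where "?U b = Some x" unfolding ran_def by blast
    from Us[OF this] show "x \<in> A" using A by blast
  qed
  ultimately show ?thesis
    unfolding super_skew_tableaux_def mem_Collect_eq
  proof (intro conjI allI impI; (elim conjE)?)
    fix i j x y
    show "x \<le> y" if "?U (i, j) = Some x" "?U (i, j + 1) = Some y"
      using step[OF that] by (simp add: adj_def)
    show "x \<le> y" if "?U (i, j) = Some x" "?U (i + 1, j) = Some y"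
      using step[OF that] by (simp add: adj_def)
    show "deg x = 0" if "x = y" "?U (i, j) = Some x" "?U (i, j + 1) = Some y"
      using step[OF that(2,3)] that(1) by (simp add: adj_def before_def)
    show "deg x = 1" if "x = y" "?U (i, j) = Some x" "?U (i + 1, j) = Some y"
      using step[OF that(2,3)] that(1) by (simp add: adj_def before_def)
  qed
qed

lemma row_reading_word:
  assumes lam: "is_partition lam" and N: "diagram lam \<subseteq> {..<N} \<times> {..<N}"
    and U: "dom U = diagram lam - diagram mu"
  shows "row_reading lam mu U = word N U"
proof -
  have a: "antimono lam" and f: "finite {i. lam i \<noteq> 0}" using lam by (auto simp: is_partition_def)
  \<comment> \<open>\<open>num_rows\<close> is a cardinality; since the parts decrease, the nonzero
    ones form an initial segment, so it is also the index of the first zero part.\<close>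
  have nz: "{i. lam i \<noteq> 0} = {..<num_rows lam}"
  proof (cases "\<exists>i. lam i = 0")
    case True
    define m where "m = (LEAST i. lam i = 0)"
    have "lam m = 0" unfolding m_def using True by (auto intro: LeastI_ex)
    have "{i. lam i \<noteq> 0} = {..<m}"
    proof (intro equalityI subsetI)
      fix i assume "i \<in> {i. lam i \<noteq> 0}"
      then show "i \<in> {..<m}" using monotoneD[OF a, of m i] \<open>lam m = 0\<close> by (cases "i < m") auto
    next
      fix i assume "i \<in> {..<m}"
      then show "i \<in> {i. lam i \<noteq> 0}" using not_less_Least[of i "\<lambda>i. lam i = 0"] by (auto simp: m_def)
    qed
    then show ?thesis by (simp add: num_rows_def)
  next
    case False
    then have "{i. lam i \<noteq> 0} = UNIV" by auto
    then show ?thesis using f by simp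
  qed
  have rows: "lam i = 0 \<longleftrightarrow> num_rows lam \<le> i" for i
  proof -
    have "i \<in> {i. lam i \<noteq> 0} \<longleftrightarrow> i \<in> {..<num_rows lam}" by (simp only: nz)
    then show ?thesis by auto
  qed
  have le: "num_rows lam \<le> N" and lamN: "lam i \<le> N" for i
  proof -
    have "N \<notin> {i. lam i \<noteq> 0}" using N by (force simp: diagram_def)
    then show "num_rows lam \<le> N" using rows by auto
    show "lam i \<le> N"
    proof (rule ccontr)
      assume "\<not> lam i \<le> N"
      then have "(i, N) \<in> diagram lam" by (simp add: diagram_def)
      then show False using N by auto
    qed
  qed
  have dU: "U (i, j) \<noteq> None \<longleftrightarrow> mu i \<le> j \<and> j < lam i" for i j
    using U by (auto simp: set_eq_iff dom_def diagram_def)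
  have row: "row_word N U i = map (\<lambda>j. the (U (i, j))) [mu i..<lam i]" for i
    unfolding row_word_def dU filter_upt_interval[OF lamN] ..
  have "rev [0..<N] = rev [num_rows lam..<N] @ rev [0..<num_rows lam]"
    using upt_split[of 0 "num_rows lam" N] le by simp
  moreover have "concat (map (row_word N U) (rev [num_rows lam..<N])) = []"
    using rows by (auto simp: row)
  ultimately show ?thesis
    unfolding word_def row_reading_def row[abs_def] by simp
qed

section \<open>The coefficients\<close>

lemma ideal_grows: "order_ideal M \<Longrightarrow> \<exists>cs. grows {} cs M"
proof (induction "card M" arbitrary: M)
  case 0
  then have "M = {}" using idealD(1) by auto
  then have "grows {} [] M" using 0 by simp
  then show ?case ..
next
  case (Suc n)
  then have "M \<noteq> {}" by auto
  then obtain c where c: "inner_corner M c" using no_inner_corner[OF Suc.prems] by blast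
  note i = inner_corner_ideal[OF Suc.prems c]
  have "card (M - {c}) = n" using Suc.hyps(2) i(2) by simp
  then obtain cs where "grows {} cs (M - {c})" using Suc.hyps(1) i(1) by blast
  moreover have "grows (M - {c}) [c] M" using i Suc.prems by (simp add: insert_absorb)
  ultimately have "grows {} (cs @ [c]) M" unfolding grows_append by blast
  then show ?case ..
qed

lemma switch_consistent:
  fixes f :: "nat \<Rightarrow> 'a::linorder"
  assumes cs: "grows {} cs M" and bs: "grows M bs L" and N: "L \<subseteq> {..<N} \<times> {..<N}"
    and m: "mono_on {..<length bs} f"
  shows "sorted_wrt (consistent f deg) (word N (numbering (fst (switch cs bs))))
    \<longleftrightarrow> sorted_wrt (consistent f deg) (word N (numbering bs))"
proof -
  have d: "distinct bs" "set bs \<subseteq> {..<N} \<times> {..<N}" using grows_set[OF bs] N by auto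
  note k = switch_knuth[OF cs bs N]
  have w: "set (word N (numbering bs)) = {..<length bs}" by (rule set_word_numbering[OF d])
  have w': "set (word N (numbering (fst (switch cs bs)))) = {..<length bs}"
    using knuth_mset[OF k] mset_eq_setD w by metis
  show ?thesis
    using knuth_consistent_map(1)[OF k, of f deg] knuth_consistent_map(1)[OF equivclp_sym[OF k], of f deg]
      w w' m by auto
qed

text \<open>\<open>cs\<close> fixes a path of rectification and \<open>N\<close> a bounding box;
  both are auxiliary choices, absent from the theorem.\<close>

locale skew_shape =
  fixes lam mu :: "nat \<Rightarrow> nat" and N :: nat and cs :: "(nat \<times> nat) list"
  assumes lam: "is_partition lam" and mu: "is_partition mu" and sub: "diagram mu \<subseteq> diagram lam"
    and N: "diagram lam \<subseteq> {..<N} \<times> {..<N}" and cs: "grows {} cs (diagram mu)"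
begin

text \<open>Write \<open>t\<close> as letters \<open>f\<close> on a standard tableau
  \<open>T1\<close>. The fillings that rectify to \<open>t\<close> are the standard ones that
  rectify to \<open>T1\<close>, decorated with the same \<open>f\<close>: consistency passes along
  the Knuth class in both directions. Finally \<open>T1\<close> is replaced by \<open>T\<close>,
  which has the same shape.\<close>

lemma rect_fibre:
  fixes A :: "'a::linorder set"
  assumes A: "finite_signed_alphabet A deg" and nu: "is_partition nu"
    and t: "t \<in> super_tableaux A deg nu" and T: "grows {} T (diagram nu)"
  shows "rect_count A deg lam mu t = std_count (diagram mu) (diagram lam) cs T"
proof -
  let ?M = "diagram mu" and ?L = "diagram lam"
  \<comment> \<open>At this point \<open>nu\<close> is not known to lie inside \<open>lam\<close>,
    so the box has to contain both diagrams.\<close>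
  obtain K where K: "diagram nu \<union> ?L \<subseteq> {..<K} \<times> {..<K}"
  proof -
    obtain K1 where "diagram nu \<subseteq> {..<K1} \<times> {..<K1}" using ideal_bounded ideal_diagram nu by blast
    then have "diagram nu \<union> ?L \<subseteq> {..<max K1 N} \<times> {..<max K1 N}" using N by force
    then show thesis by (rule that)
  qed
  then have KL: "?L \<subseteq> {..<K} \<times> {..<K}" and Kn: "diagram nu \<subseteq> {..<K} \<times> {..<K}" by auto
  obtain T1 f where T1: "grows {} T1 (diagram nu)" and tf: "t = map_option f \<circ> numbering T1"
    and m: "mono_on {..<length T1} f" and c: "sorted_wrt (consistent f deg) (word K (numbering T1))"
    and fA: "f ` {..<length T1} \<subseteq> A"
    by (rule straight_standardization_exists[OF A nu Kn t])
  have dT1: "distinct T1" "set T1 \<subseteq> {..<K} \<times> {..<K}" using grows_set[OF T1] Kn by auto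
  let ?S = "{bs. grows ?M bs ?L \<and> fst (switch cs bs) = T1}"
  have ds: "distinct bs" "set bs \<subseteq> {..<K} \<times> {..<K}" if "grows ?M bs ?L" for bs
    using grows_set[OF that] KL by auto
  have len: "length (fst (switch cs bs)) = length bs" if "grows ?M bs ?L" for bs
  proof -
    have "grows {} (cs @ bs) ?L" using cs that unfolding grows_append by blast
    then show ?thesis by (rule switch_tableau)
  qed
  have S: "mono_on {..<length bs} f" "sorted_wrt (consistent f deg) (word K (numbering bs))"
    "f ` {..<length bs} \<subseteq> A" if "bs \<in> ?S" for bs
  proof -
    have g: "grows ?M bs ?L" and s: "fst (switch cs bs) = T1" using that by auto
    have "length bs = length T1" using len[OF g] s by simp
    then show "mono_on {..<length bs} f" "f ` {..<length bs} \<subseteq> A" using m fA by auto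
    then show "sorted_wrt (consistent f deg) (word K (numbering bs))"
      using switch_consistent[OF cs g KL, of f deg] s c by simp
  qed
  have "bij_betw (\<lambda>bs. map_option f \<circ> numbering bs) ?S
    {U \<in> super_skew_tableaux A deg lam mu. Rect deg mu U = t}"
  proof (rule bij_betw_imageI)
    show "inj_on (\<lambda>bs. map_option f \<circ> numbering bs) ?S"
    proof (rule inj_onI)
      fix bs bs' assume b: "bs \<in> ?S" "bs' \<in> ?S"
        and eq: "map_option f \<circ> numbering bs = map_option f \<circ> numbering bs'"
      then have "grows ?M bs ?L" "grows ?M bs' ?L" by auto
      then show "bs = bs'"
        using standardization_unique(1)[OF ds ds S(1,2)[OF b(1)] S(1,2)[OF b(2)] eq] by blast
    qed
    show "(\<lambda>bs. map_option f \<circ> numbering bs) ` ?S =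
      {U \<in> super_skew_tableaux A deg lam mu. Rect deg mu U = t}"
    proof (intro equalityI subsetI)
      fix U assume "U \<in> (\<lambda>bs. map_option f \<circ> numbering bs) ` ?S"
      then obtain bs where bs: "bs \<in> ?S" and U: "U = map_option f \<circ> numbering bs" by blast
      have g: "grows ?M bs ?L" and s: "fst (switch cs bs) = T1" using bs by auto
      have "U \<in> super_skew_tableaux A deg lam mu"
        unfolding U by (rule super_skew_tableau_of_standard[OF g KL S[OF bs]])
      moreover have "Rect deg mu U = t"
        unfolding U tf s[symmetric] by (rule Rect_switch[OF cs g KL S(1,2)[OF bs]])
      ultimately show "U \<in> {U \<in> super_skew_tableaux A deg lam mu. Rect deg mu U = t}" by blast
    next
      fix U assume "U \<in> {U \<in> super_skew_tableaux A deg lam mu. Rect deg mu U = t}"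
      then have U: "U \<in> super_skew_tableaux A deg lam mu" and R: "Rect deg mu U = t" by auto
      obtain bs g where g: "grows ?M bs ?L" and Ug: "U = map_option g \<circ> numbering bs"
        and mg: "mono_on {..<length bs} g" and cg: "sorted_wrt (consistent g deg) (word K (numbering bs))"
        by (rule standardization_exists[OF A lam mu sub KL U])
      let ?T = "fst (switch cs bs)"
      have eq: "map_option g \<circ> numbering ?T = map_option f \<circ> numbering T1"
        using R unfolding Ug tf Rect_switch[OF cs g KL mg cg] .
      have dT: "distinct ?T \<and> set ?T \<subseteq> {..<K} \<times> {..<K}"
      proof -
        have "grows {} (cs @ bs) ?L" using cs g unfolding grows_append by blast
        then obtain D where "grows {} ?T D" "D \<subseteq> ?L" by (rule switch_tableau)
        then show ?thesis using grows_set[of "{}" ?T D] KL by auto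
      qed
      have mT: "mono_on {..<length ?T} g" using mg len[OF g] by simp
      have cT: "sorted_wrt (consistent g deg) (word K (numbering ?T))"
        using switch_consistent[OF cs g KL mg] cg by blast
      note u = standardization_unique[OF conjunct1[OF dT] conjunct2[OF dT] dT1 mT cT m c eq]
      have "bs \<in> ?S" using u(1) g by blast
      moreover have "U = map_option f \<circ> numbering bs"
      proof (rule ext)
        fix b
        show "U b = (map_option f \<circ> numbering bs) b"
          using u(2) len[OF g] numbering_eq_Some[OF ds(1)[OF g], of b]
          by (cases "numbering bs b") (auto simp: Ug)
      qed
      ultimately show "U \<in> (\<lambda>bs. map_option f \<circ> numbering bs) ` ?S" by blast
    qed
  qed
  then have "rect_count A deg lam mu t = std_count ?M ?L cs T1"
    unfolding rect_count_def std_count_def by (rule bij_betw_same_card[symmetric])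
  also have "\<dots> = std_count ?M ?L cs T" by (rule std_count_shape[OF cs cs T1 T])
  finally show ?thesis .
qed

lemma lr_coeff_eq_std_count:
  assumes nu: "is_partition nu" and T: "grows {} T (diagram nu)"
  shows "lr_coeff lam mu nu = std_count (diagram mu) (diagram lam) cs T"
  unfolding lr_coeff_def
proof (rule the_equality)
  show "\<forall>(A :: nat set) deg t. finite_signed_alphabet A deg \<and> t \<in> super_tableaux A deg nu \<longrightarrow>
    rect_count A deg lam mu t = std_count (diagram mu) (diagram lam) cs T"
    using rect_fibre[OF _ nu _ T] by blast
next
  fix c
  assume c: "\<forall>(A :: nat set) deg t. finite_signed_alphabet A deg \<and> t \<in> super_tableaux A deg nu \<longrightarrow>
    rect_count A deg lam mu t = c"
  \<comment> \<open>A tableau over natural numbers must be produced to pin down \<open>c\<close>,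
    since the defining condition could otherwise hold vacuously. The labels of \<open>T\<close>, all
    of degree 0, serve as letters.\<close>
  let ?A = "{..<length T}" and ?deg = "\<lambda>_ :: nat. 0 :: nat"
  let ?t = "map_option id \<circ> numbering T"
  have A: "finite_signed_alphabet ?A ?deg" by (auto simp: finite_signed_alphabet_def)
  obtain K where K: "diagram nu \<subseteq> {..<K} \<times> {..<K}" using ideal_bounded ideal_diagram nu by blast
  have d: "distinct T" using grows_set[OF T] by blast
  have e: "diagram empty_partition = {}" by (simp add: diagram_def)
  have cons: "sorted_wrt (consistent id ?deg) (word K (numbering T))"
    by (rule consistent_inj[OF d inj_on_id])
  have t: "?t \<in> super_tableaux ?A ?deg nu"
    by (rule super_skew_tableau_of_standard[OF _ K _ cons])
      (use T e in \<open>auto simp: mono_on_def\<close>)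
  show "c = std_count (diagram mu) (diagram lam) cs T"
    using c A t rect_fibre[OF A nu t T] by metis
qed

lemma rect_count_eq_lr_coeff:
  fixes A :: "'a::linorder set"
  assumes "finite_signed_alphabet A deg" "is_partition nu" "t \<in> super_tableaux A deg nu"
  shows "rect_count A deg lam mu t = lr_coeff lam mu nu"
proof -
  obtain T where "grows {} T (diagram nu)" using ideal_grows ideal_diagram assms(2) by blast
  then show ?thesis using rect_fibre[OF assms] lr_coeff_eq_std_count[OF assms(2)] by simp
qed

text \<open>The rectified tableau is an initial part of a chain ending at the diagram of
  \<open>lam\<close>. This bounds the shapes that occur and makes the sum over \<open>nu\<close>
  finite.\<close>

lemma lr_coeff_subset:
  assumes "is_partition nu" "lr_coeff lam mu nu \<noteq> 0"
  shows "diagram nu \<subseteq> diagram lam"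
proof -
  obtain T where T: "grows {} T (diagram nu)" using ideal_grows ideal_diagram assms(1) by blast
  have "{bs. grows (diagram mu) bs (diagram lam) \<and> fst (switch cs bs) = T} \<noteq> {}"
    using assms(2) unfolding lr_coeff_eq_std_count[OF assms(1) T] std_count_def by (metis card.empty)
  then obtain bs where bs: "grows (diagram mu) bs (diagram lam)" "fst (switch cs bs) = T" by blast
  have "grows {} (cs @ bs) (diagram lam)" using cs bs(1) unfolding grows_append by blast
  then obtain D where "grows {} T D" "D \<subseteq> diagram lam" using bs(2) by (metis switch_tableau)
  then show ?thesis using grows_set[OF T] grows_set[of "{}" T D] by simp
qed

lemma Rect_tableau:
  fixes A :: "'a::linorder set"
  assumes A: "finite_signed_alphabet A deg" and U: "U \<in> super_skew_tableaux A deg lam mu"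
  obtains nu where "is_partition nu" "Rect deg mu U \<in> super_tableaux A deg nu"
    "(word N U, word N (Rect deg mu U)) \<in> plactic_cong A deg"
proof -
  obtain bs g where g: "grows (diagram mu) bs (diagram lam)" and Ug: "U = map_option g \<circ> numbering bs"
    and mg: "mono_on {..<length bs} g" and cg: "sorted_wrt (consistent g deg) (word N (numbering bs))"
    and gA: "g ` {..<length bs} \<subseteq> A"
    by (rule standardization_exists[OF A lam mu sub N U])
  let ?T = "fst (switch cs bs)"
  have R: "Rect deg mu U = map_option g \<circ> numbering ?T"
    unfolding Ug by (rule Rect_switch[OF cs g N mg cg])
  have "grows {} (cs @ bs) (diagram lam)" using cs g unfolding grows_append by blast
  then obtain D where D: "grows {} ?T D" "D \<subseteq> diagram lam" "length ?T = length bs" by (rule switch_tableau)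
  obtain nu where nu: "is_partition nu" "D = diagram nu" using idealE grows_idealD(2)[OF D(1)] by metis
  have e: "diagram empty_partition = {}" by (simp add: diagram_def)
  have "Rect deg mu U \<in> super_tableaux A deg nu"
    unfolding R
  proof (rule super_skew_tableau_of_standard)
    show "sorted_wrt (consistent g deg) (word N (numbering ?T))"
      using switch_consistent[OF cs g N mg] cg by blast
  qed (use D nu e N mg gA in auto)
  moreover have "(word N U, word N (Rect deg mu U)) \<in> plactic_cong A deg"
    unfolding R unfolding Ug word_map_option
  proof (rule knuth_consistent_map(2)[OF switch_knuth[OF cs g N] _ cg])
    have "set (word N (numbering bs)) = {..<length bs}"
      by (rule set_word_numbering) (use grows_set[OF g] N in auto)
    then show "mono_on (set (word N (numbering bs))) g" "g ` set (word N (numbering bs)) \<subseteq> A"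
      using mg gA by simp_all
  qed
  ultimately show thesis using nu(1) that by blast
qed

end

section \<open>The identity in the monoid ring\<close>

lemma monoid_ring_simps [simp]:
  "carrier (monoid_ring M) = {f. Poly_Mapping.keys f \<subseteq> carrier M}"
  "f \<oplus>\<^bsub>monoid_ring M\<^esub> g = f + g" "\<zero>\<^bsub>monoid_ring M\<^esub> = 0"
  by (simp_all add: monoid_ring_def)

lemma abelian_monoid_monoid_ring: "abelian_monoid (monoid_ring M)"
  by (rule abelian_monoidI) (use keys_add in \<open>force simp: add.assoc add.commute\<close>)+

text \<open>Passes to the ordinary sum of finitely supported functions, where sums can be regrouped
  and interchanged.\<close>

lemma finsum_monoid_ring:
  assumes "finite S" "\<And>x. x \<in> S \<Longrightarrow> Poly_Mapping.keys (f x) \<subseteq> carrier M"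
  shows "finsum (monoid_ring M) f S = sum f S"
  using assms
proof (induction S rule: finite_induct)
  case empty
  interpret abelian_monoid "monoid_ring M" by (rule abelian_monoid_monoid_ring)
  show ?case by simp
next
  case (insert x S)
  interpret abelian_monoid "monoid_ring M" by (rule abelian_monoid_monoid_ring)
  have "finsum (monoid_ring M) f (insert x S) = f x \<oplus>\<^bsub>monoid_ring M\<^esub> finsum (monoid_ring M) f S"
    using insert by (intro finsum_insert) auto
  then show ?case using insert by simp
qed

lemma add_pow_monoid_ring: "add_pow (monoid_ring M) (n :: nat) f = (\<Sum>i<n. f)"
  by (induction n) (simp_all add: add_pow_def nat_pow_def add.commute)

lemma keys_sum_subset: "(\<And>x. x \<in> S \<Longrightarrow> Poly_Mapping.keys (f x) \<subseteq> C) \<Longrightarrow> Poly_Mapping.keys (sum f S) \<subseteq> C"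
  by (induction S rule: infinite_finite_induct) (use keys_add in \<open>force+\<close>)

lemma sum_constant_card:
  fixes c :: "'a::comm_monoid_add"
  shows "finite S \<Longrightarrow> (\<Sum>x\<in>S. c) = (\<Sum>i<card S. c)"
  by (induction S rule: finite_induct) (simp_all add: add.commute)

lemma finite_super_skew_tableaux:
  assumes "finite A" "finite (diagram lam)"
  shows "finite (super_skew_tableaux A deg lam mu)"
proof (rule finite_subset)
  show "super_skew_tableaux A deg lam mu \<subseteq> {U. dom U = diagram lam - diagram mu \<and> ran U \<subseteq> A}"
    by (auto simp: super_skew_tableaux_def)
  show "finite {U. dom U = diagram lam - diagram mu \<and> ran U \<subseteq> A}"
    by (rule finite_set_of_finite_maps) (use assms in auto)
qed

lemma skew_schur_sum:
  fixes A :: "'a::linorder set"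
  assumes A: "finite A" and lam: "is_partition lam" and N: "diagram lam \<subseteq> {..<N} \<times> {..<N}"
  shows "skew_schur A deg lam mu =
    (\<Sum>U\<in>super_skew_tableaux A deg lam mu. Poly_Mapping.single (plactic_cong A deg `` {word N U}) 1)"
    and "Poly_Mapping.keys (skew_schur A deg lam mu) \<subseteq> carrier (plactic_monoid A deg)"
proof -
  let ?S = "super_skew_tableaux A deg lam mu"
  let ?e = "\<lambda>U. Poly_Mapping.single (plactic_cong A deg `` {word N U}) (1 :: int)"
  have fin: "finite ?S" using finite_super_skew_tableaux A idealD(1) ideal_diagram lam by blast
  have dom: "dom U = diagram lam - diagram mu" "ran U \<subseteq> A" if "U \<in> ?S" for U
    using that by (auto simp: super_skew_tableaux_def)
  have e: "tableau_element A deg lam mu U = ?e U" if "U \<in> ?S" for U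
    unfolding tableau_element_def row_reading_word[OF lam N dom(1)[OF that]] ..
  have k: "Poly_Mapping.keys (?e U) \<subseteq> carrier (plactic_monoid A deg)" if "U \<in> ?S" for U
  proof -
    have "set (word N U) = ran U" by (rule set_word) (use dom[OF that] N in auto)
    then have "word N U \<in> lists A" using dom(2)[OF that] by auto
    then show ?thesis by (simp add: plactic_monoid_def quotientI)
  qed
  have "skew_schur A deg lam mu = sum (tableau_element A deg lam mu) ?S"
    unfolding skew_schur_def by (rule finsum_monoid_ring[OF fin]) (simp only: e k)
  also have "\<dots> = (\<Sum>U\<in>?S. ?e U)" by (intro sum.cong e) auto
  finally show eq: "skew_schur A deg lam mu = (\<Sum>U\<in>?S. ?e U)" .
  show "Poly_Mapping.keys (skew_schur A deg lam mu) \<subseteq> carrier (plactic_monoid A deg)"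
    unfolding eq by (rule keys_sum_subset) (rule k)
qed

lemma plactic_cong_class_eq:
  "(u, v) \<in> plactic_cong A deg \<Longrightarrow> plactic_cong A deg `` {u} = plactic_cong A deg `` {v}"
  by (auto intro: plactic_cong.sym plactic_cong.trans)

section \<open>Grouping skew tableaux by rectification\<close>

context skew_shape
begin

lemma finite_lr_support: "finite {nu. is_partition nu \<and> lr_coeff lam mu nu \<noteq> 0}"
proof (rule finite_imageD)
  show "finite (diagram ` {nu. is_partition nu \<and> lr_coeff lam mu nu \<noteq> 0})"
    by (rule finite_subset[of _ "Pow (diagram lam)"])
      (use lr_coeff_subset idealD(1)[OF ideal_diagram[OF lam]] in auto)
  show "inj_on diagram {nu. is_partition nu \<and> lr_coeff lam mu nu \<noteq> 0}"
    by (rule inj_onI) (rule diagram_inject)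
qed

text \<open>A skew tableau and its rectification have the same class in the monoid, so the sum may
  be regrouped by the value of \<open>Rect\<close>; the fibre over each tableau of shape
  \<open>nu\<close> has \<open>lr_coeff lam mu nu\<close> elements.\<close>

lemma skew_schur_expansion:
  fixes A :: "'a::linorder set"
  assumes A: "finite_signed_alphabet A deg"
  shows "skew_schur A deg lam mu =
    (\<Oplus>\<^bsub>plactic_ring A deg\<^esub>nu\<in>{nu. is_partition nu \<and> lr_coeff lam mu nu \<noteq> 0}.
      add_pow (plactic_ring A deg) (lr_coeff lam mu nu) (schur A deg nu))"
proof -
  let ?P = "{nu. is_partition nu \<and> lr_coeff lam mu nu \<noteq> 0}"
  let ?S = "super_skew_tableaux A deg lam mu"
  let ?T = "\<lambda>nu. super_tableaux A deg nu"
  let ?e = "\<lambda>U. Poly_Mapping.single (plactic_cong A deg `` {word N U}) (1 :: int)"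
  have finA: "finite A" using A by (simp add: finite_signed_alphabet_def)
  have finS: "finite ?S"
    using finite_super_skew_tableaux finA idealD(1) ideal_diagram lam by blast
  have P: "is_partition nu" "diagram nu \<subseteq> {..<N} \<times> {..<N}" if "nu \<in> ?P" for nu
    using that lr_coeff_subset N by blast+
  have finT: "finite (?T nu)" if "nu \<in> ?P" for nu
    using finite_super_skew_tableaux finA idealD(1) ideal_diagram P(1)[OF that] by blast
  have domT: "dom t = diagram nu" if "t \<in> ?T nu" for t nu
    using that by (auto simp: super_skew_tableaux_def diagram_def)
  \<comment> \<open>The coefficient of the shape reached is nonzero because \<open>U\<close> itself
    is counted by it, so regrouping over \<open>?P\<close> loses no term.\<close>
  have R: "\<exists>nu \<in> ?P. Rect deg mu U \<in> ?T nu" if U: "U \<in> ?S" for U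
  proof -
    obtain nu where nu: "is_partition nu" "Rect deg mu U \<in> ?T nu" by (rule Rect_tableau[OF A U])
    have "card {V \<in> ?S. Rect deg mu V = Rect deg mu U} \<noteq> 0" using finS U by auto
    then have "lr_coeff lam mu nu \<noteq> 0"
      using rect_count_eq_lr_coeff[OF A nu] by (simp add: rect_count_def)
    then show ?thesis using nu by blast
  qed
  have "skew_schur A deg lam mu = (\<Sum>U\<in>?S. ?e U)" by (rule skew_schur_sum(1)[OF finA lam N])
  also have "\<dots> = (\<Sum>U\<in>?S. ?e (Rect deg mu U))"
  proof (rule sum.cong[OF HOL.refl])
    fix U assume U: "U \<in> ?S"
    have "(word N U, word N (Rect deg mu U)) \<in> plactic_cong A deg" by (rule Rect_tableau[OF A U])
    from plactic_cong_class_eq[OF this] show "?e U = ?e (Rect deg mu U)" by simp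
  qed
  also have "\<dots> = (\<Sum>t\<in>(\<Union>nu\<in>?P. ?T nu). \<Sum>U\<in>{U \<in> ?S. Rect deg mu U = t}. ?e (Rect deg mu U))"
    by (rule sum.group[symmetric]) (use finS finite_lr_support finT R in auto)
  also have "\<dots> = (\<Sum>nu\<in>?P. \<Sum>t\<in>?T nu. \<Sum>U\<in>{U \<in> ?S. Rect deg mu U = t}. ?e (Rect deg mu U))"
  proof (rule sum.UNION_disjoint)
    \<comment> \<open>A tableau determines its shape through its domain, so the fibres for different
      shapes are disjoint.\<close>
    have "nu = nu'" if "t \<in> ?T nu" "t \<in> ?T nu'" for t nu nu'
      using domT that diagram_inject by metis
    then show "\<forall>nu\<in>?P. \<forall>nu'\<in>?P. nu \<noteq> nu' \<longrightarrow> ?T nu \<inter> ?T nu' = {}" by blast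
  qed (use finite_lr_support finT in auto)
  also have "\<dots> = (\<Sum>nu\<in>?P. \<Sum>t\<in>?T nu. \<Sum>i<lr_coeff lam mu nu. ?e t)"
  proof (intro sum.cong HOL.refl)
    fix nu t assume nu: "nu \<in> ?P" and t: "t \<in> ?T nu"
    have "card {U \<in> ?S. Rect deg mu U = t} = lr_coeff lam mu nu"
      using rect_count_eq_lr_coeff[OF A P(1)[OF nu] t] by (simp add: rect_count_def)
    moreover have "(\<Sum>U\<in>{U \<in> ?S. Rect deg mu U = t}. ?e (Rect deg mu U)) =
      (\<Sum>U\<in>{U \<in> ?S. Rect deg mu U = t}. ?e t)" by (intro sum.cong) auto
    moreover have "finite {U \<in> ?S. Rect deg mu U = t}" using finS by simp
    note sum_constant_card[OF this]
    ultimately show "(\<Sum>U\<in>{U \<in> ?S. Rect deg mu U = t}. ?e (Rect deg mu U)) =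
      (\<Sum>i<lr_coeff lam mu nu. ?e t)" by simp
  qed
  also have "\<dots> = (\<Sum>nu\<in>?P. \<Sum>i<lr_coeff lam mu nu. \<Sum>t\<in>?T nu. ?e t)"
    by (intro sum.cong HOL.refl sum.swap)
  also have "\<dots> = (\<Sum>nu\<in>?P. add_pow (plactic_ring A deg) (lr_coeff lam mu nu) (schur A deg nu))"
    unfolding add_pow_monoid_ring
  proof (intro sum.cong HOL.refl)
    fix nu assume nu: "nu \<in> ?P"
    show "(\<Sum>t\<in>?T nu. ?e t) = schur A deg nu"
      by (rule skew_schur_sum(1)[OF finA P[OF nu], symmetric])
  qed
  also have "\<dots> = (\<Oplus>\<^bsub>plactic_ring A deg\<^esub>nu\<in>?P. add_pow (plactic_ring A deg) (lr_coeff lam mu nu) (schur A deg nu))"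
  proof (rule finsum_monoid_ring[OF finite_lr_support, symmetric])
    fix nu assume nu: "nu \<in> ?P"
    show "Poly_Mapping.keys (add_pow (plactic_ring A deg) (lr_coeff lam mu nu) (schur A deg nu))
      \<subseteq> carrier (plactic_monoid A deg)"
      unfolding add_pow_monoid_ring by (rule keys_sum_subset) (rule skew_schur_sum(2)[OF finA P[OF nu]])
  qed
  finally show ?thesis .
qed

end

theorem theorem5p1p1:
  fixes lam mu :: "nat \<Rightarrow> nat"
  assumes "is_partition lam" and "is_partition mu" and "diagram mu \<subseteq> diagram lam"
  shows "(\<forall>nu. is_partition nu \<longrightarrow>
      (\<forall>(A :: 'a::linorder set) deg t.
        finite_signed_alphabet A deg \<and> t \<in> super_tableaux A deg nu \<longrightarrow>
        rect_count A deg lam mu t = lr_coeff lam mu nu)) \<and>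
    finite {nu. is_partition nu \<and> lr_coeff lam mu nu \<noteq> 0} \<and>
    (\<forall>(A :: 'a::linorder set) deg. finite_signed_alphabet A deg \<longrightarrow>
      skew_schur A deg lam mu =
        (\<Oplus>\<^bsub>plactic_ring A deg\<^esub>nu\<in>{nu. is_partition nu \<and> lr_coeff lam mu nu \<noteq> 0}.
          add_pow (plactic_ring A deg) (lr_coeff lam mu nu) (schur A deg nu)))"
proof -
  obtain N where N: "diagram lam \<subseteq> {..<N} \<times> {..<N}"
    using ideal_bounded ideal_diagram assms(1) by blast
  obtain cs where "grows {} cs (diagram mu)" using ideal_grows ideal_diagram assms(2) by blast
  then interpret skew_shape lam mu N cs by unfold_locales (use assms N in auto)
  show ?thesis using rect_count_eq_lr_coeff finite_lr_support skew_schur_expansion by blast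
qed

end
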